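(* Let $G$ be a finite simple graph that contains neither $P_6$ nor $C_4$ as an induced subgraph and that has no clique cutset. Then at least one of the following holds: (1) $G$ contains a vertex $v$ with $d_G(v)\le \frac{3}{2}\omega(G)-1$; (2) $G$ contains a universal vertex (a vertex adjacent to all other vertices); (3) $G$ is a blow-up of the Petersen graph; (4) $G$ is a blow-up of the graph $F$.
   Context: $P_t$ and $C_s$ denote the path on $t$ vertices and the cycle on $s$ vertices; $\omega(G)$ is the clique number. A clique cutset of $G$ is a set $K\subseteq V(G)$ inducing a clique such that $G-K$ has more connected components than $G$. A blow-up of a graph $H$ is a graph obtained by replacing each vertex $v$ of $H$ by a clique $K_v$ of size at least $1$, where $K_u$ and $K_v$ are complete to each other if $uv\in E(H)$ and anti-complete otherwise. The graph $F$ has vertices $u_1,\dots,u_6,q_1,q_2,q_3$, where $u_1u_2u_3u_4u_5u_6u_1$ is an induced $6$-cycle, $q_1$ is adjacent exactly to $u_6,u_1,u_2,u_3$, $q_2$ exactly to $u_2,u_3,u_4,u_5$, $q_3$ exactly to $u_4,u_5,u_6,u_1$, and $q_1,q_2,q_3$ are pairwise non-adjacent.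
   Formalization: G is additionally assumed to be connected and non-empty; without this the claim fails, e.g. for two disjoint copies of the Petersen graph, which have no clique cutset in the given sense but satisfy none of (1)–(4). *)

theory Defs
  imports Complex_Main "Graph_Theory.Graph_Theory"
begin

text \<open>
  A finite simple graph is a \<^locale>\<open>pair_graph\<close>: a finite vertex set together with a symmetric
  irreflexive relation on it, so each edge \<open>uv\<close> is present as the two arcs \<open>(u, v)\<close> and \<open>(v, u)\<close>.
  Consequently \<^const>\<open>out_degree\<close> is the degree, and the strongly connected components
  \<^const>\<open>pre_digraph.sccs\<close> are the connected components.
\<close>

definition path_graph :: "nat \<Rightarrow> nat pair_pre_digraph" where
  "path_graph t = \<lparr> pverts = {..<t}, parcs = ({(i, Suc i) |i. Suc i < t})\<^sup>s \<rparr>"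

text \<open>Only meaningful for \<open>s \<ge> 3\<close>.\<close>

definition cycle_graph :: "nat \<Rightarrow> nat pair_pre_digraph" where
  "cycle_graph s = \<lparr> pverts = {..<s}, parcs = ({(i, Suc i mod s) |i. i < s})\<^sup>s \<rparr>"

definition contains_induced :: "'a pair_pre_digraph \<Rightarrow> 'b pair_pre_digraph \<Rightarrow> bool" where
  "contains_induced G H \<longleftrightarrow>
     (\<exists>G'. induced_subgraph G' (with_proj G) \<and> digraph_iso G' (with_proj H))"

definition clique :: "'a pair_pre_digraph \<Rightarrow> 'a set \<Rightarrow> bool" where
  "clique G K \<longleftrightarrow> K \<subseteq> pverts G \<and> (\<forall>u\<in>K. \<forall>v\<in>K. u \<noteq> v \<longrightarrow> (u, v) \<in> parcs G)"

definition clique_number :: "'a pair_pre_digraph \<Rightarrow> nat" where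
  "clique_number G = Max (card ` {K. clique G K})"

text \<open>
  Since the number of components has to increase, the empty set is never a clique cutset, not even of
  a disconnected graph; having no clique cutset therefore does not imply being connected.
\<close>

definition clique_cutset :: "'a pair_pre_digraph \<Rightarrow> 'a set \<Rightarrow> bool" where
  "clique_cutset G K \<longleftrightarrow> clique G K \<and>
     card (pre_digraph.sccs (with_proj G \<restriction> (pverts G - K))) > card (pre_digraph.sccs (with_proj G))"

definition universal_vertex :: "'a pair_pre_digraph \<Rightarrow> 'a \<Rightarrow> bool" where
  "universal_vertex G v \<longleftrightarrow> v \<in> pverts G \<and> (\<forall>u \<in> pverts G - {v}. (v, u) \<in> parcs G)"

text \<open>
  The cliques \<open>B v\<close> partition the vertex set of \<open>G\<close>; the last conjunct is both halves
  (complete and anti-complete) at once.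
\<close>

definition is_blow_up :: "'a pair_pre_digraph \<Rightarrow> 'b pair_pre_digraph \<Rightarrow> bool" where
  "is_blow_up G H \<longleftrightarrow> (\<exists>B.
     pverts G = (\<Union>v\<in>pverts H. B v) \<and>
     (\<forall>u\<in>pverts H. \<forall>v\<in>pverts H. u \<noteq> v \<longrightarrow> B u \<inter> B v = {}) \<and>
     (\<forall>v\<in>pverts H. B v \<noteq> {} \<and> clique G (B v)) \<and>
     (\<forall>u\<in>pverts H. \<forall>v\<in>pverts H. u \<noteq> v \<longrightarrow>
        (\<forall>x\<in>B u. \<forall>y\<in>B v. (x, y) \<in> parcs G \<longleftrightarrow> (u, v) \<in> parcs H)))"

text \<open>The Petersen graph as the Kneser graph on the 2-subsets of a 5-element set.\<close>

definition petersen_graph :: "nat set pair_pre_digraph" where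
  "petersen_graph =
     (let V = {A. A \<subseteq> {..<5} \<and> card A = 2}
      in \<lparr> pverts = V, parcs = {(A, B). A \<in> V \<and> B \<in> V \<and> A \<inter> B = {}} \<rparr>)"

datatype F_vertex = U1 | U2 | U3 | U4 | U5 | U6 | Q1 | Q2 | Q3

definition F_graph :: "F_vertex pair_pre_digraph" where
  "F_graph = \<lparr> pverts = UNIV,
     parcs = ({(U1, U2), (U2, U3), (U3, U4), (U4, U5), (U5, U6), (U6, U1)}
            \<union> {Q1} \<times> {U6, U1, U2, U3}
            \<union> {Q2} \<times> {U2, U3, U4, U5}
            \<union> {Q3} \<times> {U4, U5, U6, U1})\<^sup>s \<rparr>"

end

theory Submission
  imports Defs
begin

text \<open>
  A vertex \<open>x\<close> is small, \<open>2 |N[x]| \<le> 3 \<omega>\<close>, as soon as \<open>N[x]\<close> is covered by a clique and a set of at most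
  \<open>\<omega> / 2\<close> vertices. Hence it suffices to find two vertices \<open>x\<close>, \<open>y\<close> and disjoint sets \<open>L\<close>, \<open>M\<close> such that
  \<open>N[x] - L\<close>, \<open>N[y] - M\<close> and \<open>L \<union> M\<close> are cliques: one of \<open>x\<close>, \<open>y\<close> is then small.

  Without a clique cutset every induced 5-cycle is dominating. If there is no induced 6-cycle, then
  \<open>G - N[r]\<close> is therefore chordal for every \<open>r\<close>. If for some \<open>r\<close> it is not complete, then two non-adjacent
  simplicial vertices of it, given by Dirac's theorem, form such a pair. If all \<open>G - N[r]\<close> are complete,
  take \<open>r\<close> with \<open>D = G - N[r]\<close> as large as possible; two non-adjacent vertices of \<open>N(D)\<close> with fewest
  neighbours in \<open>D\<close> form such a pair.

  If there is an induced 6-cycle, then every vertex sees on it nothing, everything, two opposite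
  vertices, or three or four consecutive ones. The vertices that see everything are universal. Except
  in two situations, a pair as above is found near the 6-cycle; in these two, every vertex looks like a
  vertex of the Petersen graph or of \<open>F\<close>.
\<close>

section \<open>Cliques, holes and simplicial vertices\<close>

text \<open>
  \<open>R\<close> is adjacency or equality. This makes the rules below free of distinctness side conditions: their
  premises already force the named vertices to be distinct.
\<close>

locale C4_P6_free =
  fixes V :: "'a set" and R :: "'a \<Rightarrow> 'a \<Rightarrow> bool"
  assumes fin: "finite V" and ne: "V \<noteq> {}"
    and R_in: "R x y \<Longrightarrow> x \<in> V"
    and R_refl: "x \<in> V \<Longrightarrow> R x x"
    and comm: "R x y = R y x"
    and C4: "\<lbrakk>R a b; R b c; R c d; R d a; \<not> R a c; \<not> R b d\<rbrakk> \<Longrightarrow> False"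
    and P6: "\<lbrakk>R a b; R b c; R c d; R d e; R e f;
        \<not> R a c; \<not> R a d; \<not> R a e; \<not> R a f; \<not> R b d; \<not> R b e; \<not> R b f;
        \<not> R c e; \<not> R c f; \<not> R d f\<rbrakk> \<Longrightarrow> False"
begin

definition N :: "'a \<Rightarrow> 'a set" where "N x = {y. R x y}"

definition clq :: "'a set \<Rightarrow> bool" where
  "clq K \<longleftrightarrow> K \<subseteq> V \<and> (\<forall>x\<in>K. \<forall>y\<in>K. R x y)"

definition \<omega> :: nat where "\<omega> = Max (card ` {K. clq K})"

text \<open>As \<open>R\<close> is reflexive on \<open>V\<close>, \<open>N x\<close> is the closed
  neighbourhood. So this is the bound d(x) \<le> 3/2 \<omega> - 1 without division or
  subtraction.\<close>

definition small :: "'a \<Rightarrow> bool" where "small x \<longleftrightarrow> x \<in> V \<and> 2 * card (N x) \<le> 3 * \<omega>"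

definition nb :: "'a set \<Rightarrow> 'a set" where "nb X = {w \<in> V - X. \<exists>x\<in>X. R x w}"

text \<open>Connectedness by cuts instead of walks: arguments by layers only need an edge that
  leaves a proper non-empty part.\<close>

definition conn :: "'a set \<Rightarrow> bool" where
  "conn X \<longleftrightarrow> (\<forall>Y\<subseteq>X. Y \<noteq> {} \<longrightarrow> Y \<noteq> X \<longrightarrow> (\<exists>y\<in>Y. \<exists>x\<in>X - Y. R y x))"

definition pent :: "'a \<Rightarrow> 'a \<Rightarrow> 'a \<Rightarrow> 'a \<Rightarrow> 'a \<Rightarrow> bool" where
  "pent a b c d e \<longleftrightarrow> R a b \<and> R b c \<and> R c d \<and> R d e \<and> R e a \<and>
    \<not> R a c \<and> \<not> R a d \<and> \<not> R b d \<and> \<not> R b e \<and> \<not> R c e"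

definition hex :: "'a \<Rightarrow> 'a \<Rightarrow> 'a \<Rightarrow> 'a \<Rightarrow> 'a \<Rightarrow> 'a \<Rightarrow> bool" where
  "hex a b c d e f \<longleftrightarrow> R a b \<and> R b c \<and> R c d \<and> R d e \<and> R e f \<and> R f a \<and>
    \<not> R a c \<and> \<not> R a d \<and> \<not> R a e \<and> \<not> R b d \<and> \<not> R b e \<and> \<not> R b f \<and>
    \<not> R c e \<and> \<not> R c f \<and> \<not> R d f"

lemma N_sub: "N x \<subseteq> V"
  using R_in comm by (auto simp: N_def)

lemma clq_card: "clq K \<Longrightarrow> card K \<le> \<omega>"
proof -
  assume K: "clq K"
  have "{K. clq K} \<subseteq> Pow V" by (auto simp: clq_def)
  then have "finite {K. clq K}" using fin by (meson finite_Pow_iff finite_subset)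
  then show ?thesis unfolding \<omega>_def using K by (intro Max_ge) auto
qed

text \<open>A clique has at most \<omega> vertices, so card (N x) \<le> \<omega> + card L, card (N
  y) \<le> \<omega> + card M and card L + card M \<le> \<omega>. The two closed neighbourhoods
  together have at most 3 \<omega> vertices, and the smaller one at most half of that.\<close>

lemma small_of_cliques:
  assumes V: "x \<in> V" "y \<in> V"
    and A: "clq (N x - L)" and B: "clq (N y - M)"
    and LM: "clq (L \<union> M)" and disj: "L \<inter> M = {}"
  shows "small x \<or> small y"
proof -
  have f: "finite L" "finite M" "finite (N x)" "finite (N y)"
    using LM N_sub fin by (auto simp: clq_def intro: finite_subset)
  have "card (N x) \<le> card (N x - L) + card L"
    using f by (metis card_Un_le card_mono finite_Un Un_Diff_cancel2 Un_upper1 finite_Diff order_trans)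
  moreover have "card (N y) \<le> card (N y - M) + card M"
    using f by (metis card_Un_le card_mono finite_Un Un_Diff_cancel2 Un_upper1 finite_Diff order_trans)
  moreover have "card L + card M = card (L \<union> M)" using f disj by (simp add: card_Un_disjoint)
  ultimately show ?thesis
    using clq_card[OF A] clq_card[OF B] clq_card[OF LM] V by (auto simp: small_def)
qed

text \<open>A connected subset of \<open>W\<close> through \<open>b\<close> of maximum size is
  closed under adjacency in \<open>W\<close>, because adding a neighbour keeps it connected. It is
  the component of \<open>b\<close> in the graph induced by \<open>W\<close>.\<close>

lemma component:
  assumes "b \<in> W" "W \<subseteq> V"
  obtains X where "b \<in> X" "X \<subseteq> W" "conn X" "\<And>x w. x \<in> X \<Longrightarrow> w \<in> W \<Longrightarrow> R x w \<Longrightarrow> w \<in> X"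
proof -
  let ?P = "\<lambda>Y. b \<in> Y \<and> Y \<subseteq> W \<and> conn Y"
  have fW: "finite W" using assms fin finite_subset by blast
  have "?P {b}" using assms by (auto simp: conn_def)
  moreover have "\<forall>Y. ?P Y \<longrightarrow> card Y < Suc (card W)"
    using fW by (auto simp: less_Suc_eq_le card_mono)
  ultimately obtain Y where Y: "?P Y" and mx: "\<And>Z. ?P Z \<Longrightarrow> card Z \<le> card Y"
    using ex_has_greatest_nat[of ?P "{b}" card "Suc (card W)"] by (metis (no_types, lifting))
  have "w \<in> Y" if x: "x \<in> Y" and w: "w \<in> W" and xw: "R x w" for x w
  proof (rule ccontr)
    assume nw: "w \<notin> Y"
    have "conn (insert w Y)"
      unfolding conn_def
    proof (intro allI impI)
      fix Z assume Z: "Z \<subseteq> insert w Y" "Z \<noteq> {}" "Z \<noteq> insert w Y"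
      show "\<exists>y\<in>Z. \<exists>x\<in>insert w Y - Z. R y x"
      proof (cases "w \<in> Z")
        case False
        then have "Z \<subseteq> Y" using Z by blast
        then show ?thesis
          using Z Y x xw False unfolding conn_def by (cases "Z = Y") blast+
      next
        case True
        show ?thesis
        proof (cases "Z = {w}")
          case True
          then show ?thesis using x xw comm nw by blast
        next
          case False
          then have "Z - {w} \<subseteq> Y" "Z - {w} \<noteq> {}" "Z - {w} \<noteq> Y" using Z True by auto
          then obtain z y where "z \<in> Z - {w}" "y \<in> Y - (Z - {w})" "R z y"
            using Y unfolding conn_def by blast
          then show ?thesis using nw by blast
        qed
      qed
    qed
    then have "?P (insert w Y)" using Y w by blast
    then have "card (insert w Y) \<le> card Y" by (rule mx)
    moreover have "finite Y" using Y fW finite_subset by blast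
    ultimately show False using nw by simp
  qed
  then show thesis using that Y by blast
qed

text \<open>
  The layers \<open>A0\<close>, \<open>A1\<close>, \<open>A2\<close> of \<open>X\<close> around \<open>s\<close> exhaust \<open>X\<close>: with a vertex of a further layer, \<open>a\<close> and \<open>s\<close>
  would begin an induced path on six vertices.
\<close>

lemma hole:
  assumes X: "conn X" and anti: "\<And>x. x \<in> X \<Longrightarrow> \<not> R a x"
    and st: "R a s" "R a t" "\<not> R s t"
    and sx: "x \<in> X" "R s x" and ty: "y \<in> X" "R t y"
  shows "\<exists>e\<in>X. \<exists>f\<in>X. pent a s e f t \<or> (\<exists>g\<in>X. hex a s e g f t)"
proof -
  define A0 where "A0 = {x\<in>X. R s x}"
  define A1 where "A1 = {x\<in>X - A0. \<exists>e\<in>A0. R e x}"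
  define A2 where "A2 = {x\<in>X - A0 - A1. \<exists>f\<in>A1. R f x}"
  let ?Y = "A0 \<union> A1 \<union> A2"
  have YX: "?Y = X"
  proof (rule ccontr)
    assume "?Y \<noteq> X"
    moreover have "?Y \<subseteq> X" "?Y \<noteq> {}" using sx by (auto simp: A0_def A1_def A2_def)
    ultimately obtain g h where gh: "g \<in> ?Y" "h \<in> X - ?Y" "R g h"
      using X unfolding conn_def by blast
    then have "g \<in> A2" by (auto simp: A1_def A2_def)
    then obtain f where f: "f \<in> A1" "R f g" by (auto simp: A2_def)
    then obtain e where e: "e \<in> A0" "R e f" by (auto simp: A1_def)
    have "\<not> R a e" "\<not> R a f" "\<not> R a g" "\<not> R a h" "\<not> R s f" "\<not> R s g" "\<not> R s h" "R s e"
      "\<not> R e g" "\<not> R e h" "\<not> R f h"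
      using anti \<open>g \<in> A2\<close> f e gh by (auto simp: A0_def A1_def A2_def)
    then show False using P6[of a s e f g h] st f e gh by blast
  qed
  \<comment> \<open>A common neighbour of \<open>s\<close> and \<open>t\<close> in \<open>X\<close>
    would close the 4-cycle \<open>a s e t\<close>.\<close>
  have t0: "\<not> R t e" if "e \<in> A0" for e
    using C4[of a s e t] that anti st comm by (auto simp: A0_def)
  \<comment> \<open>If \<open>y\<close> is in \<open>A1\<close>, a pentagon closes at once. If it is
    in \<open>A2\<close>, reached through \<open>f\<close>, the hole is a pentagon or a hexagon
    according to whether \<open>t\<close> sees \<open>f\<close>.\<close>
  have "y \<in> A1 \<or> y \<in> A2" using YX ty t0 by auto
  then show ?thesis
  proof
    assume y1: "y \<in> A1"
    then obtain e where e: "e \<in> A0" "R e y" by (auto simp: A1_def)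
    have "pent a s e y t"
      using y1 e t0[OF e(1)] anti st ty unfolding pent_def
      by (auto simp: A0_def A1_def comm[of t] comm[of _ a])
    then show ?thesis using y1 e by (auto simp: A0_def A1_def)
  next
    assume y2: "y \<in> A2"
    then obtain f where f: "f \<in> A1" "R f y" by (auto simp: A2_def)
    then obtain e where e: "e \<in> A0" "R e f" by (auto simp: A1_def)
    have in_X: "e \<in> X" "f \<in> X" "y \<in> X" using y2 e f by (auto simp: A0_def A1_def A2_def)
    have h: "R s e" "\<not> R s f" "\<not> R s y" "\<not> R e y" "\<not> R t e" "\<not> R e t"
      using y2 e f t0[OF e(1)] comm by (auto simp: A0_def A1_def A2_def)
    show ?thesis
    proof (cases "R t f")
      case True
      then have "pent a s e f t" using h st anti[OF in_X(1)] anti[OF in_X(2)] e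
        unfolding pent_def by (metis comm)
      then show ?thesis using in_X by blast
    next
      case False
      then have "hex a s e f y t" using h st anti[OF in_X(1)] anti[OF in_X(2)] anti[OF in_X(3)] e f ty
        unfolding hex_def by (metis comm)
      then show ?thesis using in_X by blast
    qed
  qed
qed

section \<open>Simplicial vertices of chordal induced subgraphs\<close>

definition simplicial :: "'a set \<Rightarrow> 'a \<Rightarrow> bool" where
  "simplicial H d \<longleftrightarrow> d \<in> H \<and> clq (N d \<inter> H)"

text \<open>\<open>X\<close> is the component of \<open>b\<close> among the non-neighbours of
  \<open>a\<close> in \<open>H\<close>, and \<open>S\<close> is its attachment. Non-adjacent
  vertices of \<open>S\<close> would, by \<open>hole\<close>, lie on a pentagon or hexagon inside
  \<open>H\<close>, so \<open>S\<close> is a clique. By induction there is a simplicial vertex on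
  each side of \<open>S\<close>.\<close>

lemma dirac:
  assumes "H \<subseteq> V" "\<not> clq H"
    and "\<And>a b c d e. pent a b c d e \<Longrightarrow> \<not> {a, b, c, d, e} \<subseteq> H"
    and "\<And>a b c d e f. hex a b c d e f \<Longrightarrow> \<not> {a, b, c, d, e, f} \<subseteq> H"
  shows "\<exists>c d. simplicial H c \<and> simplicial H d \<and> \<not> R c d"
  using assms
proof (induction "card H" arbitrary: H rule: less_induct)
  case less
  have fH: "finite H" using less.prems(1) fin finite_subset by blast
  obtain a b where ab: "a \<in> H" "b \<in> H" "\<not> R a b"
    using less.prems by (auto simp: clq_def)
  define W where "W = {x \<in> H. \<not> R a x}"
  have "b \<in> W" "W \<subseteq> V" using ab less.prems(1) by (auto simp: W_def)
  then obtain X where X: "b \<in> X" "X \<subseteq> W" "conn X"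
    and Xmax: "\<And>x w. x \<in> X \<Longrightarrow> w \<in> W \<Longrightarrow> R x w \<Longrightarrow> w \<in> X" by (rule component) blast
  define S where "S = {s \<in> H - X. \<exists>x\<in>X. R s x}"
  have Sa: "R a s" if "s \<in> S" for s
    using that Xmax comm by (auto simp: S_def W_def)
  have aX: "a \<notin> X" using X(2) R_refl less.prems(1) ab by (auto simp: W_def)
  have aS: "a \<notin> S" using X(2) by (auto simp: S_def W_def)
  have cS: "clq S"
    unfolding clq_def
  proof (intro conjI ballI)
    show "S \<subseteq> V" using less.prems(1) by (auto simp: S_def)
    fix s t assume s: "s \<in> S" and t: "t \<in> S"
    show "R s t"
    proof (rule ccontr)
      assume st: "\<not> R s t"
      obtain x y where xy: "x \<in> X" "R s x" "y \<in> X" "R t y" using s t by (auto simp: S_def)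
      have anti: "\<And>x. x \<in> X \<Longrightarrow> \<not> R a x" using X(2) by (auto simp: W_def)
      have H: "X \<subseteq> H" "S \<subseteq> H" using X(2) by (auto simp: S_def W_def)
      obtain e f where ef: "e \<in> X" "f \<in> X"
        and "pent a s e f t \<or> (\<exists>g\<in>X. hex a s e g f t)"
        using hole[OF X(3) anti Sa[OF s] Sa[OF t] st xy] by blast
      then consider "pent a s e f t" | g where "g \<in> X" "hex a s e g f t" by blast
      then show False
      proof cases
        case 1
        then show False using less.prems(3)[OF 1] H ab(1) s t ef by auto
      next
        case 2
        then show False using less.prems(4)[OF 2(2)] H ab(1) s t ef by auto
      qed
    qed
  qed
  have XH: "X \<subseteq> H" using X(2) by (auto simp: W_def)
  \<comment> \<open>Used for the two sides \<open>X\<close> and \<open>H - X - S\<close>. A vertex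
    of \<open>Y\<close> has all its \<open>H\<close>-neighbours in \<open>Y \<union> S\<close>, so
    being simplicial there is the same as being simplicial in \<open>H\<close>.\<close>
  have sub: "\<exists>c. simplicial H c \<and> c \<in> Y"
    if Y: "Y \<subseteq> H" "Y \<noteq> {}" "Y \<inter> S = {}" and nbY: "\<And>y z. y \<in> Y \<Longrightarrow> z \<in> H \<Longrightarrow> R y z \<Longrightarrow> z \<in> Y \<union> S"
      and lt: "Y \<union> S \<noteq> H" for Y
  proof -
    let ?H = "Y \<union> S"
    have sH: "?H \<subset> H" using Y lt by (auto simp: S_def)
    have up: "simplicial H c" if "simplicial ?H c" "c \<in> Y" for c
    proof -
      have "N c \<inter> H = N c \<inter> ?H" using nbY[OF that(2)] sH by (auto simp: N_def)
      then show ?thesis using that sH by (auto simp: simplicial_def)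
    qed
    show ?thesis
    proof (cases "clq ?H")
      case True
      then have "clq (N c \<inter> ?H)" for c by (auto simp: clq_def)
      then show ?thesis using up Y by (auto simp: simplicial_def)
    next
      case False
      have "\<exists>c d. simplicial ?H c \<and> simplicial ?H d \<and> \<not> R c d"
      proof (rule less.hyps)
        show "card ?H < card H" using sH fH psubset_card_mono by blast
        show "?H \<subseteq> V" using sH less.prems(1) by blast
        show "\<not> clq ?H" by fact
        show "\<And>a b c d e. pent a b c d e \<Longrightarrow> \<not> {a, b, c, d, e} \<subseteq> ?H"
          using less.prems(3) sH by (meson psubset_imp_subset subset_trans)
        show "\<And>a b c d e f. hex a b c d e f \<Longrightarrow> \<not> {a, b, c, d, e, f} \<subseteq> ?H"
          using less.prems(4) sH by (meson psubset_imp_subset subset_trans)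
      qed
      then obtain c d where cd: "simplicial ?H c" "simplicial ?H d" "\<not> R c d" by blast
      \<comment> \<open>The clique \<open>S\<close> cannot contain both of the non-adjacent vertices
        \<open>c\<close> and \<open>d\<close>.\<close>
      then have "c \<in> Y \<or> d \<in> Y" using cS by (auto simp: simplicial_def clq_def)
      then show ?thesis using up cd by blast
    qed
  qed
  have "\<exists>c. simplicial H c \<and> c \<in> X"
  proof (rule sub)
    show "X \<subseteq> H" by (fact XH)
    show "X \<noteq> {}" using X by blast
    show "X \<inter> S = {}" by (auto simp: S_def)
    show "X \<union> S \<noteq> H" using ab aX aS by blast
  qed (use comm in \<open>auto simp: S_def\<close>)
  then obtain c where c: "simplicial H c" "c \<in> X" by blast
  have "\<exists>d. simplicial H d \<and> d \<in> H - X - S"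
  proof (rule sub)
    show "H - X - S \<noteq> {}" using ab aX aS by blast
    show "H - X - S \<union> S \<noteq> H" using XH X(1) by (auto simp: S_def)
    show "\<And>y z. y \<in> H - X - S \<Longrightarrow> z \<in> H \<Longrightarrow> R y z \<Longrightarrow> z \<in> H - X - S \<union> S"
      by (auto simp: S_def)
  qed auto
  then obtain d where d: "simplicial H d" "d \<in> H - X - S" by blast
  have "\<not> R c d" using c(2) d(2) comm by (auto simp: S_def)
  then show ?case using c d by blast
qed

end

text \<open>\<open>sep\<close> expresses the absence of clique cutsets: if the attachment of
  \<open>X\<close> is a clique, nothing lies beyond it. For an empty attachment this is
  connectedness. A universal vertex is outcome (2), hence \<open>no_universal\<close>.\<close>

locale C4_P6_free_atom = C4_P6_free +
  assumes sep: "\<lbrakk>X \<noteq> {}; X \<subseteq> V; clq (nb X)\<rbrakk> \<Longrightarrow> X \<union> nb X = V"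
    and no_universal: "x \<in> V \<Longrightarrow> \<exists>y\<in>V. \<not> R x y"
begin

text \<open>Take the component \<open>X\<close> of \<open>b\<close> among the non-neighbours of
  \<open>a\<close>. Its attachment lies in the neighbourhood of \<open>a\<close> and separates
  \<open>X\<close> from \<open>a\<close>, so it is not a clique, and \<open>hole\<close> applies to
  two non-adjacent vertices of it.\<close>

lemma hole_at:
  assumes "a \<in> V" "b \<in> V" "\<not> R a b"
  shows "\<exists>s e f t. pent a s e f t \<or> (\<exists>g. hex a s e g f t)"
proof -
  define W where "W = {x \<in> V. \<not> R a x}"
  have "b \<in> W" "W \<subseteq> V" using assms by (auto simp: W_def)
  then obtain X where X: "b \<in> X" "X \<subseteq> W" "conn X"
    and Xmax: "\<And>x w. x \<in> X \<Longrightarrow> w \<in> W \<Longrightarrow> R x w \<Longrightarrow> w \<in> X" by (rule component) blast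
  have aN: "R a s" if "s \<in> nb X" for s
    using that Xmax comm by (auto simp: nb_def W_def)
  have "a \<notin> X \<union> nb X" using X(2) comm R_refl assms(1) by (auto simp: nb_def W_def)
  then have "\<not> clq (nb X)" using sep[of X] X \<open>W \<subseteq> V\<close> assms(1) by blast
  then obtain s t where st: "s \<in> nb X" "t \<in> nb X" "\<not> R s t" by (auto simp: clq_def nb_def)
  then obtain x y where xy: "x \<in> X" "R s x" "y \<in> X" "R t y" using comm by (auto simp: nb_def)
  have anti: "\<And>x. x \<in> X \<Longrightarrow> \<not> R a x" using X(2) by (auto simp: W_def)
  from hole[OF X(3) anti aN[OF st(1)] aN[OF st(2)] st(3) xy] show ?thesis by blast
qed

text \<open>
  Here and below, finite case distinctions over adjacencies are refuted by listing the relevant instances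
  of the forbidden subgraph rules; the rest is propositional.
\<close>

lemma pent_attached:
  assumes "pent c1 c2 c3 c4 c5"
    and "\<not> R z c1" "\<not> R z c2" "\<not> R z c3" "\<not> R z c4" "\<not> R z c5"
    and "\<not> R w c1" "\<not> R w c2" "\<not> R w c3" "\<not> R w c4" "\<not> R w c5"
    and "R a z" "R b w"
    and "R a c1 \<or> R a c2 \<or> R a c3 \<or> R a c4 \<or> R a c5"
    and "R b c1 \<or> R b c2 \<or> R b c3 \<or> R b c4 \<or> R b c5"
  shows "R a b"
  using assms C4[of a c1 b w] C4[of a c2 b c4] C4[of a c2 b c5] C4[of a c3 b w] C4[of a c5 b w]
    C4[of c1 a c3 b] C4[of c1 a c4 b] C4[of c1 a z b] C4[of c1 c2 a c5] C4[of c1 c2 c3 b]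
    C4[of c1 c5 c4 a] C4[of c1 c5 c4 b] C4[of c2 a w b] C4[of c2 a z b] C4[of c2 c1 a c3]
    C4[of c3 a c5 b] C4[of c3 a z b] C4[of c3 c2 a c4] C4[of c3 c2 b c4] C4[of c3 c4 c5 b]
    C4[of c4 a w b] C4[of c4 a z b] C4[of c4 c3 a c5] C4[of c5 a z b] P6[of a c2 c3 c4 b w]
    P6[of a c4 c5 c1 b w] P6[of b c2 c1 c5 a z] P6[of b c4 c5 c1 a z] P6[of c1 a z w b c4]
    P6[of c1 b w z a c4] P6[of c1 c5 c4 c3 a z] P6[of c2 c1 b c4 a z] P6[of c3 a z w b c5]
    P6[of c3 c2 c1 a z w] P6[of c3 c4 c5 c1 a z] P6[of c3 c4 c5 c1 b w] P6[of c4 c3 b c1 a z]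
    P6[of c4 c3 c2 b w z] P6[of c4 c5 b c2 a z] P6[of c4 c5 c1 c2 b w] P6[of c5 c1 c2 c3 b w]
    P6[of c5 c4 c3 c2 a z] P6[of w b c1 c5 a z] P6[of w b c4 a c2 c1] P6[of w b c4 c3 c2 c1]
    P6[of w b c5 c1 a z] P6[of w b c5 c4 c3 c2] P6[of z a c1 c2 b w] P6[of z a c1 c2 c3 b]
    P6[of z a c2 c1 b w] P6[of z a c2 c3 b w] P6[of z a c3 c2 b w] P6[of z a c3 c4 b w]
    P6[of z a c4 c3 b w] P6[of z a c4 c3 c2 c1] P6[of z a c4 c5 b w] P6[of z a c4 c5 c1 c2]
    P6[of z a c5 b c2 c3] P6[of z a c5 c4 b w] P6[of z a c5 c4 c3 c2]
  unfolding pent_def by (simp only: comm) sat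

text \<open>Take a component \<open>X\<close> of the vertices that miss the pentagon. By
  \<open>pent_attached\<close> its attachment is a clique, and this clique would separate
  \<open>X\<close> from \<open>c1\<close>.\<close>

lemma dom:
  assumes "pent c1 c2 c3 c4 c5" "z \<in> V"
  shows "R z c1 \<or> R z c2 \<or> R z c3 \<or> R z c4 \<or> R z c5"
proof (rule ccontr)
  assume nz: "\<not> ?thesis"
  define W where "W = {z \<in> V. \<not> (R z c1 \<or> R z c2 \<or> R z c3 \<or> R z c4 \<or> R z c5)}"
  have "z \<in> W" "W \<subseteq> V" using assms nz by (auto simp: W_def)
  then obtain X where X: "z \<in> X" "X \<subseteq> W" "conn X"
    and Xmax: "\<And>x w. x \<in> X \<Longrightarrow> w \<in> W \<Longrightarrow> R x w \<Longrightarrow> w \<in> X" by (rule component) blast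
  have c1: "c1 \<in> V" "R c1 c1" using assms(1) R_in R_refl by (auto simp: pent_def)
  have "c1 \<notin> X \<union> nb X" using X(2) comm c1 by (auto simp: nb_def W_def)
  then have "\<not> clq (nb X)" using sep[of X] X \<open>W \<subseteq> V\<close> c1 by blast
  then obtain a b where ab: "a \<in> nb X" "b \<in> nb X" "\<not> R a b" by (auto simp: clq_def nb_def)
  then obtain x y where xy: "x \<in> X" "R a x" "y \<in> X" "R b y" using comm by (auto simp: nb_def)
  have "x \<in> W" "y \<in> W" using xy X(2) by auto
  moreover have "a \<notin> W" "b \<notin> W" "a \<in> V" "b \<in> V" using ab Xmax by (auto simp: nb_def)
  ultimately have "R a b"
    using pent_attached[OF assms(1), of x y a b] xy by (simp add: W_def)
  with ab show False by blast
qed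

end

section \<open>Graphs without induced 6-cycles\<close>

lemma finite_min:
  fixes f :: "'a \<Rightarrow> nat"
  assumes "finite A" "A \<noteq> {}"
  obtains x where "x \<in> A" "\<And>y. y \<in> A \<Longrightarrow> f x \<le> f y"
  using arg_min_if_finite(1)[OF assms, of f] arg_min_least[OF assms, of _ f] by blast

lemma finite_max:
  fixes f :: "'a \<Rightarrow> nat"
  assumes "finite A" "A \<noteq> {}"
  obtains x where "x \<in> A" "\<And>y. y \<in> A \<Longrightarrow> f y \<le> f x"
proof -
  have "Max (f ` A) \<in> f ` A" using assms by (intro Max_in) auto
  then obtain x where "x \<in> A" "f x = Max (f ` A)" by auto
  then show thesis using that assms by (metis Max_ge finite_imageI imageI)
qed

locale hexagon_free_atom = C4_P6_free_atom +
  assumes no_hex: "\<not> hex a b c d e f"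
begin

lemma no_C6: "\<lbrakk>R a b; R b c; R c d; R d e; R e f; R f a;
    \<not> R a c; \<not> R a d; \<not> R a e; \<not> R b d; \<not> R b e; \<not> R b f;
    \<not> R c e; \<not> R c f; \<not> R d f\<rbrakk> \<Longrightarrow> False"
  using no_hex unfolding hex_def by blast

lemma pent_at:
  assumes "a \<in> V"
  shows "\<exists>s e f t. pent a s e f t"
  using no_universal[OF assms] hole_at assms no_hex by blast

section \<open>Two non-adjacent simplicial vertices of a non-neighbourhood\<close>

context
  fixes r d1 d2
  assumes r: "\<not> R r d1" "\<not> R r d2" and d: "\<not> R d1 d2"
    and simp1: "\<And>a b. \<lbrakk>R d1 a; R d1 b; \<not> R r a; \<not> R r b\<rbrakk> \<Longrightarrow> R a b"
    and simp2: "\<And>a b. \<lbrakk>R d2 a; R d2 b; \<not> R r a; \<not> R r b\<rbrakk> \<Longrightarrow> R a b"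
begin

text \<open>The first of four configurations arising in \<open>simplicial_pair_small\<close>. There
  \<open>xi\<close> and \<open>qi\<close> are neighbours of \<open>di\<close> outside the
  neighbourhood of \<open>r\<close>, while \<open>si\<close> and \<open>yi\<close> are inside. The
  outer vertices \<open>x1\<close>, \<open>x2\<close> are equal or non-adjacent, and so are the
  inner vertices \<open>y1\<close>, \<open>y2\<close>; the four lemmas treat the four
  combinations.\<close>

lemma simplicial_pair_apart:
  assumes "R d1 x1" "R d1 q1" "R d1 s1" "R d1 y1" "\<not> R r x1" "\<not> R r q1" "R r s1" "R r y1"
    and "R d2 x2" "R d2 q2" "R d2 s2" "R d2 y2" "\<not> R r x2" "\<not> R r q2" "R r s2" "R r y2"
    and "\<not> R s1 x1" "\<not> R y1 q1" "\<not> R s2 x2" "\<not> R y2 q2"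
    and "\<not> R x1 x2" "\<not> R y1 y2"
  shows False
  using r d assms C4[of d2 y2 x1 q2] C4[of q1 x1 y1 s1] C4[of r s1 d2 y2] C4[of r y1 d2 y2] C4[of s1 d1 q1 y2]
    C4[of s1 r y1 d1] C4[of y1 r y2 d1] C4[of y1 r y2 x1] no_C6[of d2 q1 x1 y1 r y2]
    no_C6[of y1 q2 d2 y2 x1 d1] P6[of d2 y2 r s1 d1 x1] P6[of d2 y2 r y1 d1 q1]
    P6[of d2 y2 r y1 d1 x1] P6[of y1 d1 x1 y2 d2 q2] simp1[of x1 q1] simp1[of x1 q2]
    simp2[of x1 x2]
  by (simp only: comm) sat

lemma simplicial_pair_common_outer:
  assumes "R d1 x1" "R d1 q1" "R d1 s1" "R d1 y1" "\<not> R r x1" "\<not> R r q1" "R r s1" "R r y1"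
    and "R d2 x1" "R d2 q2" "R d2 s2" "R d2 y2" "\<not> R r q2" "R r s2" "R r y2"
    and "\<not> R s1 x1" "\<not> R y1 q1" "\<not> R s2 x1" "\<not> R y2 q2"
    and "\<not> R y1 y2"
  shows False
  using r d assms C4[of d1 s1 y2 q1] C4[of d2 s2 s1 q2] C4[of r s1 d2 y2] C4[of r y2 d2 s2] C4[of s1 r y1 d1]
    C4[of x1 d1 s1 y2] C4[of x1 d1 s2 d2] C4[of x1 q1 s1 y1] C4[of x1 y2 s2 q2] C4[of y1 r y2 d1]
    C4[of y1 r y2 d2] no_C6[of d1 q2 d2 y2 r s1] no_C6[of d1 y1 r y2 d2 x1]
    no_C6[of d2 s2 r s1 d1 x1] no_C6[of q1 d2 y2 r y1 d1] no_C6[of x1 d1 s1 r y2 d2]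
    P6[of d1 s1 r y2 d2 q2] P6[of d2 y2 r y1 d1 q1] simp1[of x1 q1] simp2[of x1 q2]
  by (simp only: comm) sat

lemma simplicial_pair_common_both:
  assumes "R d1 x1" "R d1 q1" "R d1 s1" "R d1 y1" "\<not> R r x1" "\<not> R r q1" "R r s1" "R r y1"
    and "R d2 x1" "R d2 q2" "R d2 s2" "R d2 y1" "\<not> R r q2" "R r s2"
    and "\<not> R s1 x1" "\<not> R y1 q1" "\<not> R s2 x1" "\<not> R y1 q2"
  shows False
  using r d assms C4[of d1 q1 s2 y1] C4[of d1 x1 d2 s2] C4[of q1 d1 y1 d2] C4[of q1 x1 y1 s1] C4[of r s1 d1 y1]
    C4[of x1 d1 s1 d2] C4[of x1 d1 s1 q2] C4[of x1 d1 y1 d2] C4[of x1 y1 s2 q2] C4[of y1 d1 q2 d2]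
    C4[of y1 r s2 d2] no_C6[of q1 q2 d2 s2 s1 d1] P6[of q1 d1 s1 s2 d2 q2] P6[of q2 x1 d1 s1 r s2]
    simp1[of x1 q1] simp2[of x1 q2]
  by (simp only: comm) sat

lemma simplicial_pair_common_inner:
  assumes "R d1 y" "R d1 q1" "\<not> R r q1" "\<not> R y q1" "R d2 y" "R d2 q2" "\<not> R r q2" "\<not> R y q2" "R r y"
    and "R d1 x1" "R d1 s1" "\<not> R r x1" "R r s1" "\<not> R s1 x1"
    and "R d2 x2" "R d2 s2" "\<not> R r x2" "R r s2" "\<not> R s2 x2"
    and "\<not> R x1 x2"
  shows False
proof -
  have "\<not> R q1 q2"
    using r d assms C4[of d1 q1 q2 s1] C4[of d1 y d2 q1] C4[of d1 y d2 q2] C4[of d2 y x1 q2] C4[of q2 d2 s2 x1]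
    C4[of r y d1 s1] C4[of r y d2 s2] C4[of x2 y s2 q2] C4[of y d1 q1 s2] C4[of y x1 q1 s1]
    P6[of d1 q1 q2 d2 s2 r] P6[of d2 q2 q1 d1 s1 r] P6[of r s1 d2 q2 q1 x1] P6[of x1 q1 q2 d2 y r]
    P6[of x2 q2 x1 d1 s2 r] P6[of x2 q2 x1 d1 y r] simp1[of q1 x1] simp1[of x1 x2] simp2[of q2 x2]
    simp2[of x1 x2]
    by (simp only: comm) sat
  \<comment> \<open>A pentagon through the common inner vertex \<open>y\<close> supplies the further
    vertices for the contradiction.\<close>
  obtain a e f b where p: "pent y a e f b" using pent_at R_in comm assms(1) by blast
  have V: "r \<in> V" "d1 \<in> V" "d2 \<in> V" "q1 \<in> V" "q2 \<in> V" using R_in comm assms by blast+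
  note dm = dom[OF p]
  show False
    using r d assms(1-9) \<open>\<not> R q1 q2\<close> p V
      C4[of a d1 b d2] C4[of a q2 f e] C4[of a r b d1] C4[of a r b d2] C4[of d1 y a q1]
    C4[of d1 y b f] C4[of d1 y b q1] C4[of d1 y d2 e] C4[of d2 y a e] C4[of r y d1 e]
    C4[of r y d1 f] C4[of r y d2 e] C4[of r y d2 f] C4[of y a q1 b] C4[of y d1 e a]
    C4[of y d1 f d2] C4[of y d2 f b] C4[of y d2 q2 a] C4[of y d2 q2 b] C4[of y r f b]
    no_C6[of d1 y d2 q2 f q1] no_C6[of d2 y a e f q2] no_C6[of e q1 d1 y d2 q2]
    P6[of e f b y d1 q1] P6[of e f d2 y d1 q1] P6[of e q1 d1 y d2 q2] P6[of e q2 d2 y d1 q1]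
    P6[of f e a y d1 q1] P6[of f e a y d2 q2] P6[of f q1 d1 y d2 q2] P6[of q1 a y b f q2]
    P6[of q1 d1 a e f q2] P6[of q1 d1 y b f q2] P6[of q1 d1 y d2 e f] P6[of q1 f e d2 y r]
    P6[of q1 f q2 d2 y r] P6[of q2 d2 y b f e] P6[of q2 d2 y d1 e f] P6[of q2 d2 y d1 f e]
    P6[of q2 f e d1 y r] P6[of r y d1 q1 e q2] P6[of r y d1 q1 f q2] P6[of r y d2 q2 e q1]
    simp1[of q1 e] simp1[of q1 f] simp1[of q1 q2] simp2[of q1 q2] simp2[of q2 a] simp2[of q2 e]
    simp2[of q2 f]
    unfolding pent_def by (simp only: comm) sat
qed

text \<open>The neighbours of \<open>d\<close> inside the neighbourhood of \<open>r\<close> form a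
  clique, as there is no 4-cycle through \<open>r\<close> and \<open>d\<close>; those outside form a
  clique since \<open>d\<close> is simplicial. Missing edges therefore join the two parts, and
  removing either the outer ends (\<open>X d\<close>) or the inner ends (\<open>Y d\<close>) of all
  of them leaves a clique. If neither removal lets \<open>small_of_cliques\<close> succeed, one of
  the four configurations above occurs.\<close>

lemma simplicial_pair_small:
  assumes d1: "d1 \<in> V" and d2: "d2 \<in> V"
  shows "small d1 \<or> small d2"
proof (rule ccontr)
  assume ns: "\<not> ?thesis"
  define X where "X d = {q. R d q \<and> \<not> R r q \<and> (\<exists>s. R d s \<and> R r s \<and> \<not> R s q)}" for d
  define Y where "Y d = {s. R d s \<and> R r s \<and> (\<exists>q. R d q \<and> \<not> R r q \<and> \<not> R s q)}" for d
  have inner: "R s t" if "R d s" "R d t" "R r s" "R r t" "\<not> R r d" for d s t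
    using C4[of d s r t] that comm[of s r] comm[of t d] comm[of d r] by blast
  have outer: "R s t" if "R d s" "R d t" "\<not> R r s" "\<not> R r t" "d \<in> {d1, d2}" for d s t
    using simp1 simp2 that by blast
  have sub: "X d \<subseteq> V" "Y d \<subseteq> V" for d using R_in comm by (auto simp: X_def Y_def)
  have clX: "clq (N d - X d)" and clY: "clq (N d - Y d)" if "d \<in> {d1, d2}" for d
  proof -
    have rd: "\<not> R r d" using that r by blast
    have "R a b" if h: "R d a" "R d b"
      and "\<not> R r a \<Longrightarrow> R r b \<Longrightarrow> R b a" "R r a \<Longrightarrow> \<not> R r b \<Longrightarrow> R a b" for a b
    proof (cases "R r a")
      case True
      then show ?thesis using inner[OF h True _ rd] that(4) by blast
    next
      case False
      then show ?thesis using outer[OF h False _ \<open>d \<in> {d1, d2}\<close>] that(3) comm[of b a]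
        by (cases "R r b") simp_all
    qed
    note * = this
    show "clq (N d - X d)"
      unfolding clq_def
    proof (intro conjI ballI)
      fix a b assume "a \<in> N d - X d" "b \<in> N d - X d"
      then show "R a b" by - (rule *, auto simp: X_def N_def)
    qed (use N_sub in auto)
    show "clq (N d - Y d)"
      unfolding clq_def
    proof (intro conjI ballI)
      fix a b assume "a \<in> N d - Y d" "b \<in> N d - Y d"
      then show "R a b" by - (rule *, auto simp: Y_def N_def)
    qed (use N_sub in auto)
  qed
  have clXX: "R x y" if "x \<in> X d" "y \<in> X d" "d \<in> {d1, d2}" for x y d
    using that outer by (auto simp: X_def)
  have clYY: "R x y" if "x \<in> Y d" "y \<in> Y d" "d \<in> {d1, d2}" for x y d
    using that inner[of d x y] r by (auto simp: Y_def)
  have join: "clq (Z d1 \<union> Z d2) \<and> Z d1 \<inter> Z d2 = {}"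
    if "\<And>d. Z d \<subseteq> V" "\<And>x y d. x \<in> Z d \<Longrightarrow> y \<in> Z d \<Longrightarrow> d \<in> {d1, d2} \<Longrightarrow> R x y"
      and Z: "\<And>x y. x \<in> Z d1 \<Longrightarrow> y \<in> Z d2 \<Longrightarrow> x \<noteq> y \<and> R x y" for Z
  proof -
    have "R y x" if "x \<in> Z d1" "y \<in> Z d2" for x y using Z[OF that] comm[of y x] by simp
    then show ?thesis using that unfolding clq_def by fast
  qed
  have "\<not> (clq (X d1 \<union> X d2) \<and> X d1 \<inter> X d2 = {})"
    using small_of_cliques[OF d1 d2 clX clX] ns by blast
  then obtain x1 x2 where x: "x1 \<in> X d1" "x2 \<in> X d2" "x1 = x2 \<or> \<not> R x1 x2"
    using join[of X] clXX sub by blast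
  have "\<not> (clq (Y d1 \<union> Y d2) \<and> Y d1 \<inter> Y d2 = {})"
    using small_of_cliques[OF d1 d2 clY clY] ns by blast
  then obtain y1 y2 where y: "y1 \<in> Y d1" "y2 \<in> Y d2" "y1 = y2 \<or> \<not> R y1 y2"
    using join[of Y] clYY sub by blast
  obtain s1 s2 where s: "R d1 s1" "R r s1" "\<not> R s1 x1" "R d2 s2" "R r s2" "\<not> R s2 x2"
    using x by (auto simp: X_def)
  obtain q1 q2 where q: "R d1 q1" "\<not> R r q1" "\<not> R y1 q1" "R d2 q2" "\<not> R r q2" "\<not> R y2 q2"
    using y by (auto simp: Y_def)
  have xy: "R d1 x1" "\<not> R r x1" "R d2 x2" "\<not> R r x2" "R d1 y1" "R r y1" "R d2 y2" "R r y2"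
    using x y by (auto simp: X_def Y_def)
  show False
    using x(3) y(3) s q xy simplicial_pair_apart[of x1 q1 s1 y1 x2 q2 s2 y2]
      simplicial_pair_common_outer[of x1 q1 s1 y1 q2 s2 y2]
      simplicial_pair_common_both[of x1 q1 s1 y1 q2 s2]
      simplicial_pair_common_inner[of y1 q1 q2 x1 s1 x2 s2]
    by blast
qed

end

text \<open>Suppose that \<open>s\<close> misses \<open>d1\<close>. Avoiding 4-cycles then forces in
  turn that \<open>a\<close> sees \<open>d3\<close>, \<open>b\<close> misses \<open>d3\<close>,
  \<open>s\<close> sees \<open>d2\<close> and \<open>a\<close> sees \<open>d2\<close>; now
  \<open>r a d2 b\<close> is an induced 4-cycle.\<close>

lemma path_center:
  assumes "R r s" "R r a" "R r b" "\<not> R r d1" "\<not> R r d2" "\<not> R r d3"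
    and "R s a" "R s b" "\<not> R a b" "R a d1" "R b d2" "R s d3" "R d1 d2" "R d1 d3" "R d2 d3"
  shows "R s d1"
  using assms C4[of a s d2 d1] C4[of b s d3 d2] C4[of r a d2 b] C4[of r a d3 b] C4[of s a d1 d3]
  by (simp only: comm) sat

lemma small_vertex_exists: "\<exists>x. small x"
proof (cases "\<exists>r\<in>V. \<not> clq (V - N r)")
  case True
  then obtain r where r: "r \<in> V" "\<not> clq (V - N r)" by blast
  have "\<exists>c d. simplicial (V - N r) c \<and> simplicial (V - N r) d \<and> \<not> R c d"
  proof (rule dirac)
    \<comment> \<open>A pentagon among the non-neighbours of \<open>r\<close> would fail to dominate
      \<open>r\<close>.\<close>
    show "\<not> {a, b, c, d, e} \<subseteq> V - N r" if "pent a b c d e" for a b c d e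
      using dom[OF that r(1)] by (auto simp: N_def)
  qed (use r no_hex in auto)
  then obtain c d where cd: "simplicial (V - N r) c" "simplicial (V - N r) d" "\<not> R c d" by blast
  have "R a b" if "simplicial (V - N r) x" "R x a" "R x b" "\<not> R r a" "\<not> R r b" for x a b
    using that N_sub[of x] by (auto simp: simplicial_def clq_def N_def)
  note simp = this
  have "small c \<or> small d"
  proof (rule simplicial_pair_small[of r c d])
    show "R a b" if "R c a" "R c b" "\<not> R r a" "\<not> R r b" for a b by (rule simp[OF cd(1) that])
    show "R a b" if "R d a" "R d b" "\<not> R r a" "\<not> R r b" for a b by (rule simp[OF cd(2) that])
  qed (use cd in \<open>auto simp: simplicial_def N_def\<close>)
  then show ?thesis by blast
next
  case False
  obtain r where r: "r \<in> V" and rmax: "\<And>x. x \<in> V \<Longrightarrow> card (V - N x) \<le> card (V - N r)"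
    using finite_max[OF fin ne, of "\<lambda>x. card (V - N x)"] by blast
  define D where "D = V - N r"
  have clD: "clq D" using False r by (auto simp: D_def)
  obtain d0 where d0: "d0 \<in> D" using no_universal[OF r] by (auto simp: D_def N_def)
  \<comment> \<open>This is what the maximality of \<open>D\<close> is for: a vertex without
    neighbours in \<open>D\<close> has at least the non-neighbours of \<open>r\<close>, hence
    exactly those.\<close>
  have twin: "N x = N r" if "x \<in> V" "\<And>d. d \<in> D \<Longrightarrow> \<not> R x d" for x
  proof -
    have "D \<subseteq> V - N x" using that by (auto simp: D_def N_def)
    moreover have "card (V - N x) \<le> card D" using rmax that by (simp add: D_def)
    moreover have "finite (V - N x)" using fin by simp
    ultimately have "D = V - N x" using card_seteq by blast
    then show ?thesis using N_sub[of x] N_sub[of r] by (auto simp: D_def)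
  qed
  define S where "S = {s \<in> V. R r s \<and> (\<exists>d\<in>D. R s d)}"
  define P where "P s = N s \<inter> D" for s
  have "nb D = S" unfolding nb_def S_def D_def N_def by (auto simp: comm)
  moreover have "r \<notin> D \<union> S" using r R_refl by (auto simp: D_def S_def N_def)
  ultimately have nS: "\<not> clq S" using sep[of D] d0 r by (auto simp: D_def)
  \<comment> \<open>\<open>P s\<close> is the trace of \<open>s\<close> on \<open>D\<close>. The
    middle vertex of an induced path \<open>a s b\<close> in \<open>S\<close> has a trace containing
    those of both ends, and strictly so, since the traces of \<open>a\<close> and \<open>b\<close>
    are disjoint and non-empty. A vertex of minimum trace is thus never such a middle
    vertex.\<close>
  have center: "P a \<union> P b \<subseteq> P s" if "a \<in> S" "b \<in> S" "s \<in> S" "R s a" "R s b" "\<not> R a b" for a b s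
  proof -
    have "P a \<subseteq> P s" if h: "a \<in> S" "b \<in> S" "s \<in> S" "R s a" "R s b" "\<not> R a b" for a b s
    proof
      fix d1 assume "d1 \<in> P a"
      then have d1: "d1 \<in> D" "R a d1" by (auto simp: P_def N_def)
      obtain d2 d3 where "d2 \<in> D" "R b d2" "d3 \<in> D" "R s d3" using h by (auto simp: S_def)
      then have "R s d1"
        using path_center[of r s a b d1 d2 d3] h d1 clD by (auto simp: S_def D_def N_def clq_def)
      then show "d1 \<in> P s" using d1 by (simp add: P_def N_def)
    qed
    from this[of a b s] this[of b a s] show ?thesis using that comm[of a b] by blast
  qed
  have disj: "P a \<inter> P b = {}" if "a \<in> S" "b \<in> S" "\<not> R a b" for a b
  proof -
    have False if "d \<in> P a" "d \<in> P b" for d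
      using that \<open>a \<in> S\<close> \<open>b \<in> S\<close> \<open>\<not> R a b\<close> C4[of r a d b] comm[of d b] comm[of b r]
      by (auto simp: P_def S_def D_def N_def)
    then show ?thesis by blast
  qed
  have Pne: "P s \<noteq> {}" if "s \<in> S" for s using that by (auto simp: P_def S_def N_def)
  have fP: "finite (P s)" for s using fin by (auto simp: P_def D_def)
  \<comment> \<open>Outside \<open>D\<close>, the neighbours of \<open>s\<close> lie in
    \<open>S\<close> or are twins of \<open>r\<close>; a twin of \<open>r\<close> sees everything
    that \<open>r\<close> sees.\<close>
  have cl: "clq (N s - P s)" if s: "s \<in> S"
    and noc: "\<And>a b. a \<in> S \<Longrightarrow> b \<in> S \<Longrightarrow> R s a \<Longrightarrow> R s b \<Longrightarrow> R a b" for s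
  proof -
    have "x \<in> S \<or> N x = N r" if "x \<in> N s - P s" for x
    proof -
      have "x \<in> V" "x \<notin> D" using that N_sub by (auto simp: P_def)
      then show ?thesis using twin[of x] by (auto simp: S_def D_def N_def)
    qed
    moreover have "x \<in> N r" if "x \<in> N s - P s" for x using that N_sub by (auto simp: P_def D_def)
    moreover have "R a b" if "N a = N r" "b \<in> N r" for a b using that by (auto simp: N_def)
    moreover have "R a b" if "N b = N r" "a \<in> N r" for a b
      using that comm[of a b] by (auto simp: N_def)
    moreover have "R a b" if "a \<in> S" "b \<in> S" "a \<in> N s - P s" "b \<in> N s - P s" for a b
      using that noc by (auto simp: N_def)
    moreover have "N s - P s \<subseteq> V" using N_sub by blast
    ultimately show ?thesis unfolding clq_def by (metis (full_types))
  qed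
  have fS: "finite S" using fin by (auto simp: S_def)
  have "S \<noteq> {}" using nS by (auto simp: clq_def)
  then obtain s where s: "s \<in> S" and smin: "\<And>x. x \<in> S \<Longrightarrow> card (P s) \<le> card (P x)"
    using finite_min[OF fS, of "\<lambda>x. card (P x)"] by blast
  have strict: "card (P a) < card (P s)" if "a \<in> S" "b \<in> S" "s \<in> S" "R s a" "R s b" "\<not> R a b" for a b s
  proof -
    have "P a \<subset> P s" using center[OF that] disj[of a b] Pne[of b] that by blast
    then show ?thesis using fP psubset_card_mono by blast
  qed
  have sc: "R a b" if "a \<in> S" "b \<in> S" "R s a" "R s b" for a b
    using strict[OF that(1,2) s that(3,4)] smin[OF that(1)] by linarith
  define S' where "S' = {t \<in> S. \<not> R s t}"
  have "S' \<noteq> {}"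
  proof
    assume "S' = {}"
    then have "R s x" if "x \<in> S" for x using that unfolding S'_def by blast
    then have "\<forall>x\<in>S. \<forall>y\<in>S. R x y" using sc by blast
    moreover have "S \<subseteq> V" by (auto simp: S_def)
    ultimately have "clq S" by (simp add: clq_def)
    then show False using nS by simp
  qed
  moreover have "finite S'" using fS by (auto simp: S'_def)
  ultimately obtain t where t: "t \<in> S'" and tmin: "\<And>x. x \<in> S' \<Longrightarrow> card (P t) \<le> card (P x)"
    using finite_min[of S' "\<lambda>x. card (P x)"] by blast
  have tc: "R a b" if "a \<in> S" "b \<in> S" "R t a" "R t b" for a b
  proof (rule ccontr)
    assume nab: "\<not> R a b"
    have tS: "t \<in> S" using t by (auto simp: S'_def)
    have "\<not> R b a" using nab comm[of a b] by simp
    \<comment> \<open>Both \<open>a\<close> and \<open>b\<close> have smaller traces than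
      \<open>t\<close>, so by the choice of \<open>t\<close> neither of them is in
      \<open>S'\<close>. Both are then neighbours of \<open>s\<close>, and those are pairwise
      adjacent in \<open>S\<close>.\<close>
    then have "b \<notin> S'" using strict[OF that(2,1) tS that(4,3)] tmin[of b] by linarith
    moreover have "a \<notin> S'" using strict[OF that(1,2) tS that(3,4) nab] tmin[of a] by linarith
    ultimately have "R s a" "R s b" using that by (auto simp: S'_def)
    then show False using sc that nab by blast
  qed
  have tS: "t \<in> S" "\<not> R s t" using t by (auto simp: S'_def)
  have "clq (P s \<union> P t)" using clD by (auto simp: clq_def P_def)
  then have "small s \<or> small t"
    using small_of_cliques[OF _ _ cl[OF s sc] cl[OF tS(1) tc]] disj[OF s tS] s tS by (auto simp: S_def)
  then show ?thesis by blast
qed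

end

section \<open>Graphs with an induced 6-cycle\<close>

context C4_P6_free_atom
begin

text \<open>
  The types of a vertex \<open>x\<close> with respect to a hexagon \<open>a b c d e f\<close>. The first argument is the position
  of \<open>x\<close>: \<open>tri\<close> is centred at \<open>a\<close>, \<open>opp\<close> sees \<open>a\<close> and \<open>d\<close>, \<open>quad\<close> is centred between \<open>a\<close> and \<open>b\<close>. The other
  positions are obtained by rotating the arguments.
\<close>

definition tri :: "'a \<Rightarrow> 'a \<Rightarrow> 'a \<Rightarrow> 'a \<Rightarrow> 'a \<Rightarrow> 'a \<Rightarrow> 'a \<Rightarrow> bool" where
  "tri a b c d e f x \<longleftrightarrow> R x f \<and> R x a \<and> R x b \<and> \<not> R x c \<and> \<not> R x d \<and> \<not> R x e"

definition opp :: "'a \<Rightarrow> 'a \<Rightarrow> 'a \<Rightarrow> 'a \<Rightarrow> 'a \<Rightarrow> 'a \<Rightarrow> 'a \<Rightarrow> bool" where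
  "opp a b c d e f x \<longleftrightarrow> R x a \<and> R x d \<and> \<not> R x b \<and> \<not> R x c \<and> \<not> R x e \<and> \<not> R x f"

definition quad :: "'a \<Rightarrow> 'a \<Rightarrow> 'a \<Rightarrow> 'a \<Rightarrow> 'a \<Rightarrow> 'a \<Rightarrow> 'a \<Rightarrow> bool" where
  "quad a b c d e f x \<longleftrightarrow> R x f \<and> R x a \<and> R x b \<and> R x c \<and> \<not> R x d \<and> \<not> R x e"

definition full :: "'a \<Rightarrow> 'a \<Rightarrow> 'a \<Rightarrow> 'a \<Rightarrow> 'a \<Rightarrow> 'a \<Rightarrow> 'a \<Rightarrow> bool" where
  "full a b c d e f x \<longleftrightarrow> R x a \<and> R x b \<and> R x c \<and> R x d \<and> R x e \<and> R x f"

definition off :: "'a \<Rightarrow> 'a \<Rightarrow> 'a \<Rightarrow> 'a \<Rightarrow> 'a \<Rightarrow> 'a \<Rightarrow> 'a \<Rightarrow> bool" where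
  "off a b c d e f x \<longleftrightarrow> \<not> (R x a \<or> R x b \<or> R x c \<or> R x d \<or> R x e \<or> R x f)"

text \<open>An edge between the \<open>tri\<close> classes centred at the two hexagon neighbours of
  \<open>a\<close>. Next to a \<open>quad\<close> vertex, such an edge is the obstruction to the
  argument of \<open>no_opp_small\<close>.\<close>

definition diag :: "'a \<Rightarrow> 'a \<Rightarrow> 'a \<Rightarrow> 'a \<Rightarrow> 'a \<Rightarrow> 'a \<Rightarrow> bool" where
  "diag a b c d e f \<longleftrightarrow> (\<exists>s t. tri f a b c d e s \<and> tri b c d e f a t \<and> R s t)"

lemmas hex_defs = hex_def tri_def opp_def quad_def full_def off_def

lemma hex_rot: "hex a b c d e f \<Longrightarrow> hex b c d e f a"
  unfolding hex_def by (simp add: comm)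

lemma opp_flip: "opp d e f a b c x = opp a b c d e f x"
  unfolding opp_def by auto

lemma clqI: "(\<And>x. x \<in> K \<Longrightarrow> x \<in> V) \<Longrightarrow> (\<And>x y. x \<in> K \<Longrightarrow> y \<in> K \<Longrightarrow> R x y) \<Longrightarrow> clq K"
  by (auto simp: clq_def)

text \<open>\<open>small_of_cliques\<close> with the removed sets given by predicates
  \<open>P\<close> and \<open>Q\<close>. Every premise concerns at most two unknown vertices, which
  makes it a finite adjacency problem.\<close>

lemma small_of_clique_predicates:
  assumes V: "a \<in> V" "b \<in> V"
    and A: "\<And>x y. \<lbrakk>R x a; \<not> P x; R y a; \<not> P y\<rbrakk> \<Longrightarrow> R x y"
    and B: "\<And>x y. \<lbrakk>R x b; \<not> Q x; R y b; \<not> Q y\<rbrakk> \<Longrightarrow> R x y"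
    and PP: "\<And>x y. \<lbrakk>R x a; P x; R y a; P y\<rbrakk> \<Longrightarrow> R x y"
    and QQ: "\<And>x y. \<lbrakk>R x b; Q x; R y b; Q y\<rbrakk> \<Longrightarrow> R x y"
    and PQ: "\<And>x y. \<lbrakk>R x a; P x; R y b; Q y\<rbrakk> \<Longrightarrow> R x y"
    and disj: "\<And>x. \<lbrakk>R x a; P x; R x b; Q x\<rbrakk> \<Longrightarrow> False"
  shows "\<exists>x. small x"
proof -
  let ?L = "{x. R x a \<and> P x}" and ?M = "{x. R x b \<and> Q x}"
  have N: "x \<in> N y \<longleftrightarrow> R x y" for x y unfolding N_def using comm[of x y] by simp
  have "clq (N a - ?L)" using A R_in by (intro clqI) (auto simp: N)
  moreover have "clq (N b - ?M)" using B R_in by (intro clqI) (auto simp: N)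
  moreover have "clq (?L \<union> ?M)"
  proof (rule clqI)
    fix x y assume "x \<in> ?L \<union> ?M" "y \<in> ?L \<union> ?M"
    then show "R x y" using PP[of x y] QQ[of x y] PQ[of x y] PQ[of y x] comm[of y x] by blast
  qed (use R_in in blast)
  moreover have "?L \<inter> ?M = {}" using disj by blast
  ultimately show ?thesis using small_of_cliques[OF V] by blast
qed

section \<open>Vertex types relative to a fixed hexagon and their compatibility\<close>

context
  fixes v1 v2 v3 v4 v5 v6
  assumes hex: "hex v1 v2 v3 v4 v5 v6"
begin

lemma hex_in: "v1 \<in> V" "v2 \<in> V" "v3 \<in> V" "v4 \<in> V" "v5 \<in> V" "v6 \<in> V"
  using hex R_in unfolding hex_def by blast+

lemma full_adj:
  assumes "full v1 v2 v3 v4 v5 v6 u" "\<not> off v1 v2 v3 v4 v5 v6 w"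
  shows "R u w"
  using hex assms C4[of u v1 w v3] C4[of u v1 w v4] C4[of u v2 w v5] C4[of u v2 w v6] C4[of u v3 w v6]
    C4[of v1 u v5 w] C4[of v2 u v4 w] C4[of v3 u v5 w] C4[of v4 u v6 w] P6[of v2 v1 v6 v5 v4 w]
    P6[of v5 v6 v1 v2 v3 w] P6[of w v1 v6 v5 v4 v3] P6[of w v2 v1 v6 v5 v4]
    P6[of w v5 v6 v1 v2 v3] P6[of w v6 v1 v2 v3 v4] P6[of w v6 v5 v4 v3 v2]
  unfolding hex_defs by (simp only: comm) sat

text \<open>Meant for non-adjacent vertices \<open>a\<close>, \<open>b\<close> in the attachment of
  one component off the hexagon. Exchanging them shows that both have an \<open>opp\<close>
  type.\<close>

lemma off_attached:
  assumes "z \<in> V" "w \<in> V" "off v1 v2 v3 v4 v5 v6 z" "off v1 v2 v3 v4 v5 v6 w"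
    and "\<not> off v1 v2 v3 v4 v5 v6 a" "\<not> off v1 v2 v3 v4 v5 v6 b"
    and "R a z" "R b w" "\<not> R a b"
  shows "opp v1 v2 v3 v4 v5 v6 a \<or> opp v2 v3 v4 v5 v6 v1 a \<or> opp v3 v4 v5 v6 v1 v2 a"
  using hex assms C4[of a v1 b v3] C4[of a v2 b v4] C4[of a v2 b v6] C4[of a v3 b w] C4[of a v4 b v6]
    C4[of a v4 b z] C4[of a v5 b w] C4[of a v6 b z] C4[of v1 a v4 b] C4[of v1 a v5 b]
    C4[of v1 a w b] C4[of v1 a z b] C4[of v1 v2 v3 a] C4[of v1 v2 v3 b] C4[of v2 a v5 b]
    C4[of v2 a w b] C4[of v2 a z b] C4[of v2 v1 v6 a] C4[of v2 v3 v4 b] C4[of v3 a v5 b]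
    C4[of v3 a v6 b] C4[of v3 v2 a v4] C4[of v3 v4 v5 a] C4[of v3 v4 v5 b] C4[of v4 a w b]
    C4[of v5 a z b] C4[of v5 v4 a v6] C4[of v6 a w b] C4[of v6 v1 a v5] P6[of a v5 v4 v3 v2 v1]
    P6[of b v6 v1 v2 v3 v4] P6[of v1 v2 v3 b w z] P6[of v1 v2 v3 v4 b w] P6[of v3 v4 v5 v6 a z]
    P6[of v3 v4 v5 v6 b w] P6[of v4 a v1 v6 b w] P6[of v4 a v2 v1 v6 b] P6[of v4 v3 v2 b w z]
    P6[of v4 v3 v2 v1 b w] P6[of v4 v5 v6 v1 a z] P6[of v4 v5 v6 v1 b w] P6[of v5 v6 v1 v2 a z]
    P6[of v5 v6 v1 v2 b w] P6[of v5 v6 v1 v2 v3 b] P6[of v6 v1 v2 b w z] P6[of v6 v1 v2 v3 v4 a]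
    P6[of w b v1 v6 a z] P6[of w b v2 v1 a z] P6[of w b v3 v2 a z] P6[of w b v3 v4 a z]
    P6[of w b v5 v6 v1 v2] P6[of w b v6 v1 a z] P6[of z a v1 v2 v3 v4] P6[of z a v2 v1 b w]
    P6[of z a v3 v2 b w] P6[of z a v3 v2 v1 v6] P6[of z a v3 v4 b w] P6[of z a v4 v5 b w]
    P6[of z a v5 v4 b w] P6[of z a v5 v6 b w] P6[of z a v6 v1 v2 v3] P6[of z a v6 v5 b w]
    P6[of z w b v4 v3 v2] P6[of z w b v4 v5 v6] P6[of z w b v6 v5 v4]
  unfolding hex_defs pent_def by (simp only: comm) sat

text \<open>\<open>d v1 v2 v3 v4\<close> is a pentagon. It is dominating, and \<open>z\<close> can
  only see it in \<open>d\<close>.\<close>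

lemma opp_off:
  assumes "opp v1 v2 v3 v4 v5 v6 d" "z \<in> V" "off v1 v2 v3 v4 v5 v6 z"
  shows "R z d"
  using hex assms dom[of d v1 v2 v3 v4 z]
  unfolding hex_defs pent_def by (simp only: comm) sat

lemma opp_clique:
  assumes "opp v1 v2 v3 v4 v5 v6 a" "opp v1 v2 v3 v4 v5 v6 b"
  shows "R a b"
  using hex assms C4[of a v1 b v4]
  unfolding hex_defs by (simp only: comm) sat

lemma opp_anti:
  assumes "opp v1 v2 v3 v4 v5 v6 a" "opp v2 v3 v4 v5 v6 v1 b"
  shows "\<not> R a b"
  using hex assms C4[of a b v2 v1]
  unfolding hex_defs by (simp only: comm) sat

lemma opp_quad:
  assumes "opp v1 v2 v3 v4 v5 v6 d" "quad v1 v2 v3 v4 v5 v6 q"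
  shows False
  using hex assms C4[of v3 v4 d q] P6[of d v4 v5 v6 q v2]
  unfolding hex_defs by (simp only: comm) sat

lemma opp_quad':
  assumes "opp v1 v2 v3 v4 v5 v6 d" "quad v6 v1 v2 v3 v4 v5 q"
  shows False
  using hex assms C4[of v4 v5 q d] P6[of v6 q v2 v3 v4 d]
  unfolding hex_defs by (simp only: comm) sat

lemma quad_anti:
  assumes "quad v1 v2 v3 v4 v5 v6 p" "quad v3 v4 v5 v6 v1 v2 q"
  shows "\<not> R p q"
  using hex assms C4[of v6 v5 q p]
  unfolding hex_defs by (simp only: comm) sat

text \<open>Together with \<open>quad_diag'\<close>, \<open>diag_diag\<close>,
  \<open>quad_quad_quad\<close> and \<open>quad_quad_quad'\<close>, this provides the exclusions for
  the propositional step at the end of \<open>hexagon_cases\<close>.\<close>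

lemma quad_diag:
  assumes "quad v1 v2 v3 v4 v5 v6 q"
  shows "\<not> diag v4 v5 v6 v1 v2 v3"
proof -
  have "\<not> R s t" if "tri v3 v4 v5 v6 v1 v2 s" "tri v5 v6 v1 v2 v3 v4 t" for s t
    using hex assms that C4[of q v6 t s] C4[of v3 v4 t q] P6[of v5 t s v3 q v1]
    unfolding hex_defs by (simp only: comm) sat
  then show ?thesis by (auto simp: diag_def)
qed

lemma quad_diag':
  assumes "quad v1 v2 v3 v4 v5 v6 q"
  shows "\<not> diag v5 v6 v1 v2 v3 v4"
proof -
  have "\<not> R s t" if "tri v4 v5 v6 v1 v2 v3 s" "tri v6 v1 v2 v3 v4 v5 t" for s t
    using hex assms that C4[of q v3 s t] C4[of v5 v6 q s] P6[of v4 s t v6 q v2]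
    unfolding hex_defs by (simp only: comm) sat
  then show ?thesis by (auto simp: diag_def)
qed

lemma diag_diag:
  assumes "diag v2 v3 v4 v5 v6 v1"
  shows "\<not> diag v5 v6 v1 v2 v3 v4"
proof -
  obtain s t where st: "tri v1 v2 v3 v4 v5 v6 s" "tri v3 v4 v5 v6 v1 v2 t" "R s t"
    using assms by (auto simp: diag_def)
  have "\<not> R x y" if "tri v4 v5 v6 v1 v2 v3 x" "tri v6 v1 v2 v3 v4 v5 y" for x y
    using hex st that C4[of t s y x] C4[of v1 v2 t y] C4[of v3 v2 s x] P6[of t v3 x v5 v6 v1] P6[of v4 v3 v2 s v6 y]
    unfolding hex_defs by (simp only: comm) sat
  then show ?thesis by (auto simp: diag_def)
qed

lemma quad_quad_quad:
  assumes "quad v1 v2 v3 v4 v5 v6 a" "quad v2 v3 v4 v5 v6 v1 b" "quad v4 v5 v6 v1 v2 v3 c"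
  shows False
  using hex assms C4[of b v4 c a] C4[of v1 a v3 b] C4[of v3 a v6 c] C4[of v6 v1 b c]
  unfolding hex_defs by (simp only: comm) sat

lemma quad_quad_quad':
  assumes "quad v1 v2 v3 v4 v5 v6 a" "quad v3 v4 v5 v6 v1 v2 b" "quad v4 v5 v6 v1 v2 v3 c"
  shows False
  using hex assms C4[of a v3 c v6] C4[of b v3 c v5] C4[of v2 a c b] C4[of v5 v6 a b]
  unfolding hex_defs by (simp only: comm) sat

text \<open>Private neighbours \<open>z\<close> of \<open>x\<close> and \<open>w\<close> of
  \<open>t\<close> would produce an induced 4-cycle or six-vertex path. The closed neighbourhoods of
  one \<open>tri\<close> class therefore form a chain.\<close>

lemma tri_nested:
  assumes "tri v4 v5 v6 v1 v2 v3 x" "tri v4 v5 v6 v1 v2 v3 t" "R x z" "\<not> R t z" "R t w"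
  shows "R x w"
  using hex assms C4[of v1 v2 v3 w] C4[of v1 v2 v3 z] C4[of v1 z v3 w] C4[of v2 v3 t w] C4[of v2 v3 x z]
    C4[of v3 t v5 z] C4[of v3 x v5 t] C4[of v3 x v5 w] C4[of v5 v6 z x] C4[of v6 v1 w v5]
    C4[of v6 v1 z v5] C4[of v6 v5 t w] C4[of x t w z] P6[of v2 v3 x z v6 w] P6[of v3 t v5 v6 v1 z]
    P6[of v5 x v3 v2 v1 w] P6[of v6 w t x z v2] P6[of v6 z x t w v2] P6[of w t v3 v2 v1 v6]
    P6[of w v3 x v5 v6 v1] P6[of z v3 t v5 v6 v1] P6[of z x v3 v2 v1 v6]
  unfolding hex_defs by (simp only: comm) sat

text \<open>Choose \<open>a\<close> with the smallest closed neighbourhood in the class. By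
  \<open>tri_nested\<close> that neighbourhood is contained in those of all other members.\<close>

lemma tri_min:
  obtains a where "tri v4 v5 v6 v1 v2 v3 a" "\<And>z t. R a z \<Longrightarrow> tri v4 v5 v6 v1 v2 v3 t \<Longrightarrow> R z t"
proof -
  let ?K = "{x. tri v4 v5 v6 v1 v2 v3 x}"
  have "?K \<subseteq> V" using R_in by (auto simp: tri_def)
  then have fK: "finite ?K" using fin finite_subset by blast
  have "tri v4 v5 v6 v1 v2 v3 v4"
    using hex R_refl hex_in comm unfolding hex_def tri_def by metis
  then have "?K \<noteq> {}" by blast
  then obtain a where a: "a \<in> ?K" and amin: "\<And>t. t \<in> ?K \<Longrightarrow> card (N a) \<le> card (N t)"
    using finite_min[OF fK, of "\<lambda>x. card (N x)"] by blast
  have "R t z" if z: "R a z" and t: "tri v4 v5 v6 v1 v2 v3 t" for z t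
  proof (rule ccontr)
    assume nz: "\<not> R t z"
    have "N t \<subseteq> N a" using tri_nested[of a t z] a z t nz by (auto simp: N_def)
    moreover have "z \<in> N a - N t" using z nz by (auto simp: N_def)
    ultimately have "N t \<subset> N a" by blast
    then have "card (N t) < card (N a)" using N_sub fin finite_subset psubset_card_mono by metis
    then show False using amin[of t] t by simp
  qed
  then show thesis using that a comm by (metis mem_Collect_eq)
qed

end

text \<open>The attachment of a component off the hexagon is not a clique. Two non-adjacent vertices
  of it are of \<open>opp\<close> type by \<open>off_attached\<close>, and of different types by
  \<open>opp_clique\<close>. The three alternatives are the three pairs of types, as
  \<open>opp v4 v5 v6 v1 v2 v3\<close> is \<open>opp v1 v2 v3 v4 v5 v6\<close>.\<close>

lemma off_two_opp:
  assumes hex: "hex v1 v2 v3 v4 v5 v6" and z: "z \<in> V" "off v1 v2 v3 v4 v5 v6 z"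
  shows "\<exists>a b. (opp v1 v2 v3 v4 v5 v6 a \<and> opp v2 v3 v4 v5 v6 v1 b)
    \<or> (opp v2 v3 v4 v5 v6 v1 a \<and> opp v3 v4 v5 v6 v1 v2 b)
    \<or> (opp v3 v4 v5 v6 v1 v2 a \<and> opp v4 v5 v6 v1 v2 v3 b)"
proof -
  define W where "W = {z \<in> V. off v1 v2 v3 v4 v5 v6 z}"
  have "z \<in> W" "W \<subseteq> V" using z by (auto simp: W_def)
  then obtain X where X: "z \<in> X" "X \<subseteq> W" "conn X"
    and Xmax: "\<And>x w. x \<in> X \<Longrightarrow> w \<in> W \<Longrightarrow> R x w \<Longrightarrow> w \<in> X" by (rule component) blast
  have v1: "v1 \<in> V" "R v1 v1" using hex_in[OF hex] R_refl by auto
  have "v1 \<notin> W" using v1 by (auto simp: W_def off_def)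
  moreover have "v1 \<notin> nb X" using X(2) by (auto simp: nb_def W_def off_def)
  ultimately have "\<not> clq (nb X)" using sep[of X] X \<open>W \<subseteq> V\<close> v1 by blast
  then obtain a b where ab: "a \<in> nb X" "b \<in> nb X" "\<not> R a b" by (auto simp: clq_def nb_def)
  then obtain x y where xy: "x \<in> X" "R x a" "y \<in> X" "R y b" by (auto simp: nb_def)
  have xy': "x \<in> V" "y \<in> V" "off v1 v2 v3 v4 v5 v6 x" "off v1 v2 v3 v4 v5 v6 y" "R a x" "R b y"
    using xy X(2) comm by (auto simp: W_def)
  have ab': "\<not> off v1 v2 v3 v4 v5 v6 a" "\<not> off v1 v2 v3 v4 v5 v6 b"
    using ab xy Xmax by (auto simp: nb_def W_def)
  have ba: "\<not> R b a" using ab(3) comm[of a b] by simp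
  note * = off_attached[OF hex xy'(1-4) ab' xy'(5,6) ab(3)]
    off_attached[OF hex xy'(2,1,4,3) ab'(2,1) xy'(6,5) ba]
  have **: "hex v2 v3 v4 v5 v6 v1" "hex v3 v4 v5 v6 v1 v2" using hex hex_rot by blast+
  show ?thesis
    using * opp_clique[OF hex, of a b] opp_clique[OF **(1), of a b] opp_clique[OF **(2), of a b]
      ab(3) opp_flip[of v1 v2 v3 v4 v5 v6] by blast
qed

text \<open>A non-neighbour \<open>w\<close> of \<open>u\<close> must be off the hexagon by
  \<open>full_adj\<close>, so there are vertices \<open>a\<close>, \<open>b\<close> of two different
  \<open>opp\<close> types. They are non-adjacent and both see \<open>u\<close> and
  \<open>w\<close>, which gives the 4-cycle \<open>u a w b\<close>.\<close>

lemma not_full: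
  assumes hex: "hex v1 v2 v3 v4 v5 v6"
  shows "\<not> full v1 v2 v3 v4 v5 v6 u"
proof
  assume u: "full v1 v2 v3 v4 v5 v6 u"
  then have "u \<in> V" using R_in by (auto simp: full_def)
  then obtain w where w: "w \<in> V" "\<not> R u w" using no_universal by blast
  have off: "off v1 v2 v3 v4 v5 v6 w" using full_adj[OF hex u, of w] w by blast
  have h: "hex v2 v3 v4 v5 v6 v1" "hex v3 v4 v5 v6 v1 v2" "hex v4 v5 v6 v1 v2 v3"
    using hex hex_rot by blast+
  have offs: "off v2 v3 v4 v5 v6 v1 w" "off v3 v4 v5 v6 v1 v2 w" "off v4 v5 v6 v1 v2 v3 w"
    using off by (auto simp: off_def)
  obtain a b where ab: "R w a" "R w b" "\<not> R a b" "R u a" "R u b"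
  proof -
    have *: "R u x" if "opp v1 v2 v3 v4 v5 v6 x \<or> opp v2 v3 v4 v5 v6 v1 x \<or> opp v3 v4 v5 v6 v1 v2 x
        \<or> opp v4 v5 v6 v1 v2 v3 x" for x
      using full_adj[OF hex u, of x] that by (auto simp: opp_def off_def)
    show thesis
      using off_two_opp[OF hex w(1) off] that * opp_anti[OF hex] opp_anti[OF h(1)] opp_anti[OF h(2)]
        opp_off[OF hex _ w(1) off] opp_off[OF h(1) _ w(1) offs(1)]
        opp_off[OF h(2) _ w(1) offs(2)] opp_off[OF h(3) _ w(1) offs(3)]
      by blast
  qed
  show False using C4[of u a w b] ab w comm[of a w] comm[of b u] by blast
qed

text \<open>The candidates are the ends \<open>v3\<close>, \<open>v6\<close> of the missing opposite
  pair. The two \<open>opp\<close> types exclude every \<open>quad\<close>, so \<open>v3\<close>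
  sees only the \<open>tri\<close> classes of \<open>v2\<close>, \<open>v3\<close>,
  \<open>v4\<close>, and \<open>v6\<close> those of \<open>v5\<close>, \<open>v6\<close>,
  \<open>v1\<close>. The sets removed are the classes of \<open>v4\<close> and
  \<open>v5\<close>.\<close>

lemma two_opp_small:
  assumes hex: "hex v1 v2 v3 v4 v5 v6"
    and d: "opp v1 v2 v3 v4 v5 v6 d1" "opp v2 v3 v4 v5 v6 v1 d2"
    and no3: "\<And>x. \<not> opp v3 v4 v5 v6 v1 v2 x"
  shows "\<exists>x. small x"
proof (rule small_of_clique_predicates[of v3 v6 "\<lambda>x. R x v4 \<and> R x v5" "\<lambda>x. R x v4 \<and> R x v5"])
  note h = hex d
  have L: "R x y" if "R x v4 \<and> R x v5" "R y v4 \<and> R y v5" "R x v3 \<or> R x v6" "R y v3 \<or> R y v6" for x y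
    using h that no3[of x] no3[of y] not_full[OF hex, of x] not_full[OF hex, of y] C4[of v1 d1 v4 x] C4[of v1 d1 v4 y] C4[of v1 v2 y d1] C4[of v1 v6 v5 x] C4[of v2 v1 v6 x]
    C4[of v6 v1 y v5] C4[of x v3 y v5] C4[of x v4 y v6] C4[of x v5 y d1] P6[of d1 v1 v6 v5 y v3]
    P6[of v3 x d1 v1 v6 y] P6[of v3 x v5 v6 v1 d1] P6[of y v3 v2 v1 v6 x]
    unfolding hex_defs by (simp only: comm) sat
  show "v3 \<in> V" "v6 \<in> V" using hex_in[OF hex] by auto
  show "R x y" if "R x v3" "\<not> (R x v4 \<and> R x v5)" "R y v3" "\<not> (R y v4 \<and> R y v5)" for x y
    using h that no3[of x] no3[of y] not_full[OF hex, of x] not_full[OF hex, of y] C4[of v1 v2 y v6] C4[of v1 x v3 y] C4[of v2 v1 v6 x] C4[of v2 v3 x d2] C4[of v3 v2 d2 y]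
    C4[of v3 v4 v5 x] C4[of v3 v4 v5 y] C4[of v4 v3 x d1] C4[of v5 v4 x v6] C4[of v5 v4 y v6]
    C4[of v5 v6 y d2] C4[of v6 v5 d2 x] C4[of x v2 y v4] P6[of d2 v5 v4 v3 y v1]
    P6[of v1 x v3 v4 v5 d2] P6[of v5 v6 v1 x v3 y] P6[of v6 v5 d2 v2 v3 y] P6[of x v3 v2 d2 v5 v6]
    P6[of x v3 v4 d1 v1 v6] P6[of y v2 x v4 v5 v6]
    unfolding hex_defs by (simp only: comm) sat
  show "R x y" if "R x v6" "\<not> (R x v4 \<and> R x v5)" "R y v6" "\<not> (R y v4 \<and> R y v5)" for x y
    using h that no3[of x] no3[of y] not_full[OF hex, of x] not_full[OF hex, of y] C4[of v1 v2 y v6] C4[of v1 x v5 y] C4[of v2 v1 d1 d2] C4[of v2 v1 v6 x] C4[of v2 x v6 y]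
    C4[of v3 v4 d1 y] C4[of v3 v4 v5 y] C4[of v4 v3 x v5] C4[of v4 v5 v6 y] C4[of v5 v4 d1 y]
    C4[of v5 v4 x v6] C4[of v6 v5 d2 x] C4[of v6 v5 d2 y] P6[of d2 v5 v4 d1 v1 y]
    P6[of v1 x v3 v4 v5 d2] P6[of v4 v3 v2 y v6 x] P6[of x v1 y v5 v4 v3] P6[of x v6 v1 v2 v3 v4]
    P6[of y v6 v1 d1 v4 v3] P6[of y v6 v5 v4 v3 v2]
    unfolding hex_defs by (simp only: comm) sat
  show False if "R x v3" "R x v4 \<and> R x v5" "R x v6" "R x v4 \<and> R x v5" for x
    using h that no3[of x] not_full[OF hex, of x] C4[of v1 v2 x v6] C4[of v1 v6 x d1] C4[of v2 v1 x v3] P6[of v5 x v3 v2 v1 d1]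
    unfolding hex_defs by (simp only: comm) sat
  show "R x y" if "R x v3" "R x v4 \<and> R x v5" "R y v3" "R y v4 \<and> R y v5" for x y
    using L that by blast
  show "R x y" if "R x v6" "R x v4 \<and> R x v5" "R y v6" "R y v4 \<and> R y v5" for x y
    using L that by blast
  show "R x y" if "R x v3" "R x v4 \<and> R x v5" "R y v6" "R y v4 \<and> R y v5" for x y
    using L that by blast
qed

text \<open>The model is the Petersen graph without the vertex off the hexagon: \<open>d1\<close>
  sees the classes of \<open>d1\<close>, \<open>v1\<close>, \<open>v4\<close>, and \<open>d2\<close>
  those of \<open>d2\<close>, \<open>v2\<close>, \<open>v5\<close>. The classes of \<open>v1\<close>
  and \<open>v2\<close> are removed.\<close>

lemma three_opp_small:
  assumes hex: "hex v1 v2 v3 v4 v5 v6"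
    and d: "opp v1 v2 v3 v4 v5 v6 d1" "opp v2 v3 v4 v5 v6 v1 d2" "opp v3 v4 v5 v6 v1 v2 d3"
    and no_off: "\<And>x. x \<in> V \<Longrightarrow> \<not> off v1 v2 v3 v4 v5 v6 x"
  shows "\<exists>x. small x"
proof (rule small_of_clique_predicates[of d1 d2 "\<lambda>x. R x v1 \<and> R x v2" "\<lambda>x. R x v1 \<and> R x v2"])
  note h = hex d
  have L: "R x y" if "R x v1 \<and> R x v2" "R y v1 \<and> R y v2" "R x d1 \<or> R x d2" "R y d1 \<or> R y d2" for x y
    using h that not_full[OF hex, of x] not_full[OF hex, of y] C4[of d2 v2 y v5] C4[of v1 v6 d3 y] C4[of v1 v6 v5 x] C4[of v1 x d2 y] C4[of v2 v3 v4 y]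
    C4[of v2 x d1 y] C4[of v2 x v6 y] C4[of v3 v2 x d3] C4[of v4 v3 d3 d1] C4[of v4 v5 d2 d1]
    C4[of x v1 y v3] P6[of v3 v4 d1 v1 y d2] P6[of v3 x d2 v5 v6 y] P6[of v5 v6 d3 v3 v2 x]
    P6[of v6 v5 d2 v2 y d1] P6[of y v3 d3 v6 x d1]
    unfolding hex_defs by (simp only: comm) sat
  show "d1 \<in> V" "d2 \<in> V" using d R_in by (auto simp: opp_def)
  show "R x y" if "R x d1" "\<not> (R x v1 \<and> R x v2)" "R y d1" "\<not> (R y v1 \<and> R y v2)" for x y
    using h that no_off[OF R_in, of x d1] no_off[OF R_in, of y d1]
      not_full[OF hex, of x] not_full[OF hex, of y] C4[of v1 v2 y d1] C4[of v1 v6 x d1] C4[of v1 v6 y d1] C4[of v2 v1 d1 d2] C4[of v2 v1 d1 x]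
    C4[of v3 v2 d2 y] C4[of v3 v4 y d3] C4[of v3 x d1 y] C4[of v4 v3 x d1] C4[of v4 v3 y d1]
    C4[of v4 v5 d2 x] C4[of v4 v5 x d1] C4[of v5 v4 d1 y] C4[of v5 x d1 y] C4[of x v1 y v4]
    P6[of v1 v2 d2 v5 v4 y] P6[of v1 v6 d3 v3 v4 y] P6[of v5 d2 v2 v1 d1 x]
    P6[of v5 v4 v3 v2 v1 y] P6[of v5 x v3 v2 v1 y] P6[of x d1 y v5 d2 v2] P6[of x v1 v2 v3 v4 v5]
    P6[of x v4 v3 v2 v1 v6]
    unfolding hex_defs by (simp only: comm) sat
  show "R x y" if "R x d2" "\<not> (R x v1 \<and> R x v2)" "R y d2" "\<not> (R y v1 \<and> R y v2)" for x y
    using h that no_off[OF R_in, of x d2] no_off[OF R_in, of y d2]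
      not_full[OF hex, of x] not_full[OF hex, of y] C4[of v1 v2 d2 y] C4[of v1 v2 x d1] C4[of v2 v1 d1 y] C4[of v2 v1 x d2] C4[of v2 v3 y d2]
    C4[of v2 x v5 y] C4[of v3 v2 d2 d3] C4[of v3 v2 d2 x] C4[of v4 v5 d2 x] C4[of v4 v5 d2 y]
    C4[of v5 v4 d1 d2] C4[of v5 v6 d3 x] C4[of v6 v1 d1 x] C4[of v6 v1 d1 y] C4[of v6 x d2 y]
    P6[of d1 v1 v6 y d2 x] P6[of x d2 v2 v3 d3 v6] P6[of x v2 v1 v6 v5 v4] P6[of y d2 x v4 d1 v1]
    P6[of y d2 x v6 v1 d1] P6[of y v2 x v5 v4 d1] P6[of y v5 v6 v1 v2 v3]
    unfolding hex_defs by (simp only: comm) sat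
  show False if "R x d1" "R x v1 \<and> R x v2" "R x d2" "R x v1 \<and> R x v2" for x
    using h that not_full[OF hex, of x] C4[of v3 v2 x v4] C4[of v4 v3 x d1] C4[of v4 v5 d2 x] C4[of v4 v5 x d1] C4[of v6 v1 x v5]
    P6[of v3 v4 v5 d2 x v1]
    unfolding hex_defs by (simp only: comm) sat
  show "R x y" if "R x d1" "R x v1 \<and> R x v2" "R y d1" "R y v1 \<and> R y v2" for x y
    using L that by blast
  show "R x y" if "R x d2" "R x v1 \<and> R x v2" "R y d2" "R y v1 \<and> R y v2" for x y
    using L that by blast
  show "R x y" if "R x d1" "R x v1 \<and> R x v2" "R y d2" "R y v1 \<and> R y v2" for x y
    using L that by blast
qed

text \<open>Next to \<open>d1\<close>, a \<open>quad\<close> can only be centred between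
  \<open>v2\<close> and \<open>v3\<close> or between \<open>v5\<close> and \<open>v6\<close>. The
  sets removed from the neighbourhoods of \<open>v2\<close> and \<open>v3\<close> are the
  \<open>tri\<close> classes of \<open>v3\<close> and \<open>v2\<close>.\<close>

lemma one_opp_small:
  assumes hex: "hex v1 v2 v3 v4 v5 v6" and d: "opp v1 v2 v3 v4 v5 v6 d1"
    and no2: "\<And>x. \<not> opp v2 v3 v4 v5 v6 v1 x" and no3: "\<And>x. \<not> opp v3 v4 v5 v6 v1 v2 x"
  shows "\<exists>x. small x"
proof (rule small_of_clique_predicates[of v2 v3 "\<lambda>x. R x v4 \<and> \<not> R x v1" "\<lambda>x. R x v1 \<and> \<not> R x v4"])
  note h = hex d
  show "v2 \<in> V" "v3 \<in> V" using hex_in[OF hex] by auto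
  show "R x y" if "R x v2" "\<not> (R x v4 \<and> \<not> R x v1)" "R y v2" "\<not> (R y v4 \<and> \<not> R y v1)" for x y
    using h that no2[of x] no2[of y] no3[of x] no3[of y] not_full[OF hex, of x] not_full[OF hex, of y]
      C4[of d1 v1 x v4] C4[of v1 d1 v4 y] C4[of v1 v2 x d1] C4[of v1 v6 v5 x] C4[of v1 v6 v5 y]
    C4[of v2 v1 v6 y] C4[of v3 v2 x v4] C4[of v3 v2 y v4] C4[of v4 v3 x v5] C4[of v4 v3 y v5]
    C4[of x v1 y v3] C4[of x v2 y d1] C4[of x v2 y v6] P6[of d1 v4 v3 v2 x v6]
    P6[of d1 v4 v3 v2 y v6] P6[of v4 v5 v6 v1 v2 y] P6[of v6 v5 v4 v3 v2 x]
    P6[of v6 v5 v4 v3 v2 y] P6[of v6 x d1 v4 v3 y] P6[of v6 y d1 v4 v3 x] P6[of x v2 v1 d1 v4 v5]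
    unfolding hex_defs by (simp only: comm) sat
  show "R x y" if "R x v3" "\<not> (R x v1 \<and> \<not> R x v4)" "R y v3" "\<not> (R y v1 \<and> \<not> R y v4)" for x y
    using h that no2[of x] no2[of y] no3[of x] no3[of y] not_full[OF hex, of x] not_full[OF hex, of y]
      C4[of d1 v1 x v4] C4[of v1 d1 v4 y] C4[of v1 v2 x v6] C4[of v2 v1 v6 y] C4[of v2 v1 x v3]
    C4[of v2 v1 y v3] C4[of v4 v3 y v5] C4[of v4 v5 v6 y] C4[of v5 v4 x v6] C4[of v6 v1 d1 x]
    C4[of x v2 y v4] C4[of x v3 y d1] C4[of x v3 y v5] P6[of v1 v6 v5 v4 v3 x]
    P6[of v2 v1 v6 v5 v4 y] P6[of v3 x v5 v6 v1 d1] P6[of v5 x v3 v2 v1 d1] P6[of v5 y d1 v1 v2 x]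
    P6[of v5 y v3 v2 v1 d1] P6[of x v4 v5 v6 v1 v2] P6[of y v3 v4 v5 v6 v1] P6[of y v3 x v5 v6 v1]
    unfolding hex_defs by (simp only: comm) sat
  show "R x y" if "R x v2" "R x v4 \<and> \<not> R x v1" "R y v2" "R y v4 \<and> \<not> R y v1" for x y
    using h that no2[of x] no2[of y] no3[of x] no3[of y] not_full[OF hex, of x] not_full[OF hex, of y]
      C4[of v2 x v4 y]
    unfolding hex_defs by (simp only: comm) sat
  show "R x y" if "R x v3" "R x v1 \<and> \<not> R x v4" "R y v3" "R y v1 \<and> \<not> R y v4" for x y
    using h that no2[of x] no2[of y] no3[of x] no3[of y] not_full[OF hex, of x] not_full[OF hex, of y]
      C4[of v1 x v3 y]
    unfolding hex_defs by (simp only: comm) sat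
  show "R x y" if "R x v2" "R x v4 \<and> \<not> R x v1" "R y v3" "R y v1 \<and> \<not> R y v4" for x y
    using h that no2[of x] no2[of y] no3[of x] no3[of y] not_full[OF hex, of x] not_full[OF hex, of y]
      C4[of v1 v2 x d1] C4[of v1 v2 x v6] C4[of v2 v1 y v3] C4[of v2 v3 v4 x] C4[of v3 v4 d1 y]
    C4[of v4 v3 y v5] P6[of d1 v4 v5 v6 y v2] P6[of v5 x v3 y v1 d1] P6[of y v2 x v4 v5 v6]
    unfolding hex_defs by (simp only: comm) sat
qed blast

text \<open>Minimal members \<open>a4\<close>, \<open>a5\<close> of the \<open>tri\<close> classes
  replace \<open>v4\<close>, \<open>v5\<close>, so that all their neighbours are complete to the
  respective class. The excluded \<open>quad\<close> and \<open>diag\<close> types ensure that the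
  set removed at \<open>a4\<close> consists of \<open>tri\<close> vertices centred at
  \<open>v5\<close>.\<close>

lemma no_opp_small:
  assumes hex: "hex v1 v2 v3 v4 v5 v6"
    and no_opp: "\<And>x. \<not> opp v1 v2 v3 v4 v5 v6 x" "\<And>x. \<not> opp v2 v3 v4 v5 v6 v1 x"
      "\<And>x. \<not> opp v3 v4 v5 v6 v1 v2 x"
    and no_quad: "\<And>x. \<not> quad v4 v5 v6 v1 v2 v3 x" "\<And>x. \<not> quad v5 v6 v1 v2 v3 v4 x"
    and no_diag: "\<not> diag v5 v6 v1 v2 v3 v4"
  shows "\<exists>x. small x"
proof -
  obtain a4 where a4: "tri v4 v5 v6 v1 v2 v3 a4"
    and min4: "\<And>z t. R a4 z \<Longrightarrow> tri v4 v5 v6 v1 v2 v3 t \<Longrightarrow> R z t"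
    using tri_min[OF hex] by blast
  obtain a5 where a5: "tri v5 v6 v1 v2 v3 v4 a5"
    and min5: "\<And>z t. R a5 z \<Longrightarrow> tri v5 v6 v1 v2 v3 v4 t \<Longrightarrow> R z t"
    using tri_min[OF hex_rot[OF hex]] by blast
  have no_diag: "\<And>s t. \<lbrakk>tri v4 v5 v6 v1 v2 v3 s; tri v6 v1 v2 v3 v4 v5 t\<rbrakk> \<Longrightarrow> \<not> R s t"
    using no_diag by (auto simp: diag_def)
  have type: "\<not> full v1 v2 v3 v4 v5 v6 x \<and> \<not> opp v1 v2 v3 v4 v5 v6 x \<and> \<not> opp v2 v3 v4 v5 v6 v1 x \<and>
      \<not> opp v3 v4 v5 v6 v1 v2 x \<and> \<not> quad v4 v5 v6 v1 v2 v3 x \<and> \<not> quad v5 v6 v1 v2 v3 v4 x \<and>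
      (R x y \<longrightarrow> \<not> off v1 v2 v3 v4 v5 v6 x)" for x y
    using not_full[OF hex] no_opp no_quad off_two_opp[OF hex, of x] R_in[of x y] by blast
  note h = hex a4 a5
  show ?thesis
  proof (rule small_of_clique_predicates[of a4 a5 "\<lambda>x. R x v5 \<and> R x v6" "\<lambda>x. R x v3 \<and> R x v4"])
    show "a4 \<in> V" "a5 \<in> V" using a4 a5 R_in by (auto simp: tri_def)
    show "R x y" if "R x a4" "\<not> (R x v5 \<and> R x v6)" "R y a4" "\<not> (R y v5 \<and> R y v6)" for x y
      using h that type[of x a4] type[of y a4] C4[of v1 v6 v5 y] C4[of v2 v1 x v3] C4[of v2 v1 y v3] C4[of v3 v4 v5 y] C4[of v4 v3 x v5]
    C4[of v6 v1 x v5] C4[of v6 v5 a4 x] C4[of v6 v5 a4 y] C4[of x v2 y a4] min4[of x y]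
    min4[of y x] P6[of x a4 v5 v6 v1 v2] P6[of x v1 v6 v5 v4 v3] P6[of x v5 v6 v1 v2 v3]
    P6[of y a4 v3 v2 v1 v6] P6[of y a4 v5 v6 v1 v2] P6[of y v1 v6 v5 v4 v3]
      unfolding hex_defs by (simp only: comm) sat
    show "R x y" if "R x a5" "\<not> (R x v3 \<and> R x v4)" "R y a5" "\<not> (R y v3 \<and> R y v4)" for x y
      using h that type[of x a5] type[of y a5] C4[of v2 v1 v6 x] C4[of v2 v1 v6 y] C4[of v2 v3 v4 x] C4[of v3 v2 y v4] C4[of v3 v4 a5 x]
    C4[of v3 v4 a5 y] C4[of v4 v5 v6 x] C4[of v5 v4 y v6] C4[of x v1 y a5] min5[of x y]
    min5[of y x] P6[of v1 v2 v3 v4 a5 y] P6[of x a5 v4 v3 v2 v1] P6[of x a5 v6 v1 v2 v3]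
    P6[of x v2 v3 v4 v5 v6] P6[of y a5 v6 v1 v2 v3] P6[of y v2 v3 v4 v5 v6]
      unfolding hex_defs by (simp only: comm) sat
    show "R x y" if "R x a4" "R x v5 \<and> R x v6" "R y a4" "R y v5 \<and> R y v6" for x y
      using h that type[of x a4] type[of y a4] C4[of v6 x a4 y]
      unfolding hex_defs by (simp only: comm) sat
    show "R x y" if "R x a5" "R x v3 \<and> R x v4" "R y a5" "R y v3 \<and> R y v4" for x y
      using h that type[of x a5] type[of y a5] C4[of x v3 y a5]
      unfolding hex_defs by (simp only: comm) sat
    show "R x y" if "R x a4" "R x v5 \<and> R x v6" "R y a5" "R y v3 \<and> R y v4" for x y
      using h that type[of x a4] type[of y a5] C4[of v1 v2 v3 x] C4[of v1 v2 x v6] C4[of v3 v2 x a4] C4[of v4 v3 x v5] min5[of y x]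
    no_diag[of a4 x] P6[of v2 v1 v6 x a4 v4]
      unfolding hex_defs by (simp only: comm) sat
    show False if "R x a4" "R x v5 \<and> R x v6" "R x a5" "R x v3 \<and> R x v4" for x
      using h that type[of x a4] C4[of v2 v1 v6 x] C4[of v2 v1 x v3]
      unfolding hex_defs by (simp only: comm) sat
  qed
qed

lemma hexagon_cases:
  assumes hex: "hex v1 v2 v3 v4 v5 v6"
  obtains x where "small x"
  | v1 v2 v3 v4 v5 v6 d1 d2 d3 z where "hex v1 v2 v3 v4 v5 v6" "opp v1 v2 v3 v4 v5 v6 d1"
      "opp v2 v3 v4 v5 v6 v1 d2" "opp v3 v4 v5 v6 v1 v2 d3" "z \<in> V" "off v1 v2 v3 v4 v5 v6 z"
  | v1 v2 v3 v4 v5 v6 q1 q2 q3 where "hex v1 v2 v3 v4 v5 v6" "quad v1 v2 v3 v4 v5 v6 q1"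
      "quad v3 v4 v5 v6 v1 v2 q2" "quad v5 v6 v1 v2 v3 v4 q3"
proof -
  note outcome = that
  have two: thesis
    if hex: "hex v1 v2 v3 v4 v5 v6" and d: "opp v1 v2 v3 v4 v5 v6 d1" "opp v2 v3 v4 v5 v6 v1 d2"
    for v1 v2 v3 v4 v5 v6 d1 d2
  proof -
    consider "\<exists>x. small x"
      | d3 z where "opp v3 v4 v5 v6 v1 v2 d3" "z \<in> V" "off v1 v2 v3 v4 v5 v6 z"
      using two_opp_small[OF hex d] three_opp_small[OF hex d] by blast
    then show thesis using outcome(1) outcome(2)[OF hex d] by cases blast+
  qed
  have one: "(\<exists>x. small x) \<or> (\<exists>a b. opp v1 v2 v3 v4 v5 v6 a \<and> opp v2 v3 v4 v5 v6 v1 b)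
    \<or> (\<exists>a b. opp v3 v4 v5 v6 v1 v2 a \<and> opp v4 v5 v6 v1 v2 v3 b)"
    if hex: "hex v1 v2 v3 v4 v5 v6" and d: "opp v1 v2 v3 v4 v5 v6 d"
    for v1 v2 v3 v4 v5 v6 d
    using one_opp_small[OF hex d] d opp_flip[of v1 v2 v3 v4 v5 v6] by blast
  note r1 = hex_rot[OF hex] note r2 = hex_rot[OF r1] note r3 = hex_rot[OF r2]
  note r4 = hex_rot[OF r3] note r5 = hex_rot[OF r4]
  note hs = hex r1 r2 r3 r4 r5
  show thesis
  proof (cases "\<exists>d. opp v1 v2 v3 v4 v5 v6 d \<or> opp v2 v3 v4 v5 v6 v1 d \<or> opp v3 v4 v5 v6 v1 v2 d")
    case True
    then have "(\<exists>x. small x) \<or> (\<exists>a b. opp v1 v2 v3 v4 v5 v6 a \<and> opp v2 v3 v4 v5 v6 v1 b)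
      \<or> (\<exists>a b. opp v2 v3 v4 v5 v6 v1 a \<and> opp v3 v4 v5 v6 v1 v2 b)
      \<or> (\<exists>a b. opp v3 v4 v5 v6 v1 v2 a \<and> opp v4 v5 v6 v1 v2 v3 b)
      \<or> (\<exists>a b. opp v4 v5 v6 v1 v2 v3 a \<and> opp v5 v6 v1 v2 v3 v4 b)
      \<or> (\<exists>a b. opp v5 v6 v1 v2 v3 v4 a \<and> opp v6 v1 v2 v3 v4 v5 b)"
      using one[OF hs(1)] one[OF hs(2)] one[OF hs(3)] by blast
    then show thesis
      using two[OF hs(1)] two[OF hs(2)] two[OF hs(3)] two[OF hs(4)] two[OF hs(5)] outcome(1) by blast
  next
    case False
    then have no: "\<not> opp v1 v2 v3 v4 v5 v6 d" "\<not> opp v2 v3 v4 v5 v6 v1 d" "\<not> opp v3 v4 v5 v6 v1 v2 d"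
      "\<not> opp v4 v5 v6 v1 v2 v3 d" "\<not> opp v5 v6 v1 v2 v3 v4 d" "\<not> opp v6 v1 v2 v3 v4 v5 d" for d
      by (auto simp: opp_flip[of v1 v2 v3 v4 v5 v6] opp_flip[of v2 v3 v4 v5 v6 v1]
          opp_flip[of v3 v4 v5 v6 v1 v2])
    \<comment> \<open>Hiding the witnesses turns the analysis around the hexagon into propositional
      logic.\<close>
    define Q where "Q a b c d e f \<longleftrightarrow> (\<exists>q. quad a b c d e f q)" for a b c d e f
    have good: "\<exists>x. small x"
      if "hex a b c d e f" "\<And>x. \<not> opp a b c d e f x" "\<And>x. \<not> opp b c d e f a x"
        "\<And>x. \<not> opp c d e f a b x" "\<not> Q d e f a b c" "\<not> Q e f a b c d" "\<not> diag e f a b c d"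
      for a b c d e f
      using no_opp_small[of a b c d e f] that by (simp add: Q_def)
    have qd: "Q a b c d e f \<Longrightarrow> \<not> diag d e f a b c" "Q a b c d e f \<Longrightarrow> \<not> diag e f a b c d"
      "\<not> (Q a b c d e f \<and> Q b c d e f a \<and> Q d e f a b c)"
      "\<not> (Q a b c d e f \<and> Q c d e f a b \<and> Q d e f a b c)"
      "\<not> (diag b c d e f a \<and> diag e f a b c d)"
      if "hex a b c d e f" for a b c d e f
      using quad_diag[OF that] quad_diag'[OF that] quad_quad_quad[OF that] quad_quad_quad'[OF that]
        diag_diag[OF that] unfolding Q_def by blast+
    show thesis
    proof (cases "\<exists>x. small x")
      case True
      then show thesis using that(1) by blast
    next
      case nos: False
      \<comment> \<open>Without small vertices each of the six rotations of
        \<open>no_opp_small\<close> is obstructed. The exclusions \<open>qd\<close> then leave only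
        three \<open>quad\<close> types in alternate positions.\<close>
      have g: "Q v4 v5 v6 v1 v2 v3 \<or> Q v5 v6 v1 v2 v3 v4 \<or> diag v5 v6 v1 v2 v3 v4"
        "Q v5 v6 v1 v2 v3 v4 \<or> Q v6 v1 v2 v3 v4 v5 \<or> diag v6 v1 v2 v3 v4 v5"
        "Q v6 v1 v2 v3 v4 v5 \<or> Q v1 v2 v3 v4 v5 v6 \<or> diag v1 v2 v3 v4 v5 v6"
        "Q v1 v2 v3 v4 v5 v6 \<or> Q v2 v3 v4 v5 v6 v1 \<or> diag v2 v3 v4 v5 v6 v1"
        "Q v2 v3 v4 v5 v6 v1 \<or> Q v3 v4 v5 v6 v1 v2 \<or> diag v3 v4 v5 v6 v1 v2"
        "Q v3 v4 v5 v6 v1 v2 \<or> Q v4 v5 v6 v1 v2 v3 \<or> diag v4 v5 v6 v1 v2 v3"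
        using good[OF hs(1)] good[OF hs(2)] good[OF hs(3)] good[OF hs(4)] good[OF hs(5)]
          good[OF hs(6)] no nos by blast+
      have "(Q v1 v2 v3 v4 v5 v6 \<and> Q v3 v4 v5 v6 v1 v2 \<and> Q v5 v6 v1 v2 v3 v4) \<or>
        (Q v2 v3 v4 v5 v6 v1 \<and> Q v4 v5 v6 v1 v2 v3 \<and> Q v6 v1 v2 v3 v4 v5)"
        using g qd[OF hs(1)] qd[OF hs(2)] qd[OF hs(3)] qd[OF hs(4)] qd[OF hs(5)] qd[OF hs(6)]
        by sat
      then show thesis using that(3) hs(1,2) unfolding Q_def by blast
    qed
  qed
qed

text \<open>Supplies the premise \<open>types\<close> of \<open>blow_up_of_copy\<close> for the
  Petersen graph. Besides the forbidden subgraphs, it uses that pentagons such as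
  \<open>d1 v1 v6 d3 z\<close> are dominating.\<close>

lemma petersen_type:
  assumes hex: "hex v1 v2 v3 v4 v5 v6"
    and d: "opp v1 v2 v3 v4 v5 v6 d1" "opp v2 v3 v4 v5 v6 v1 d2" "opp v3 v4 v5 v6 v1 v2 d3"
    and z: "off v1 v2 v3 v4 v5 v6 z" and zd: "R z d1" "R z d2" "R z d3"
    and x: "x \<in> V"
  shows "tri v1 v2 v3 v4 v5 v6 x \<and> R x d1 \<and> \<not> R x d2 \<and> \<not> R x d3 \<and> \<not> R x z \<or>
    tri v2 v3 v4 v5 v6 v1 x \<and> \<not> R x d1 \<and> R x d2 \<and> \<not> R x d3 \<and> \<not> R x z \<or>
    tri v3 v4 v5 v6 v1 v2 x \<and> \<not> R x d1 \<and> \<not> R x d2 \<and> R x d3 \<and> \<not> R x z \<or>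
    tri v4 v5 v6 v1 v2 v3 x \<and> R x d1 \<and> \<not> R x d2 \<and> \<not> R x d3 \<and> \<not> R x z \<or>
    tri v5 v6 v1 v2 v3 v4 x \<and> \<not> R x d1 \<and> R x d2 \<and> \<not> R x d3 \<and> \<not> R x z \<or>
    tri v6 v1 v2 v3 v4 v5 x \<and> \<not> R x d1 \<and> \<not> R x d2 \<and> R x d3 \<and> \<not> R x z \<or>
    opp v1 v2 v3 v4 v5 v6 x \<and> R x d1 \<and> \<not> R x d2 \<and> \<not> R x d3 \<and> R x z \<or>
    opp v2 v3 v4 v5 v6 v1 x \<and> \<not> R x d1 \<and> R x d2 \<and> \<not> R x d3 \<and> R x z \<or>
    opp v3 v4 v5 v6 v1 v2 x \<and> \<not> R x d1 \<and> \<not> R x d2 \<and> R x d3 \<and> R x z \<or>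
    off v1 v2 v3 v4 v5 v6 x \<and> R x d1 \<and> R x d2 \<and> R x d3 \<and> R x z"
proof -
  note r1 = hex_rot[OF hex] note r2 = hex_rot[OF r1]
  have dd: "\<not> R d1 d2" "\<not> R d2 d3" "\<not> R d3 d1"
    using opp_anti[OF hex d(1,2)] opp_anti[OF r1 d(2,3)] opp_anti[OF r2 d(3), of d1] d(1)
      opp_flip[of v1 v2 v3 v4 v5 v6 d1] by blast+
  show ?thesis
    using hex d z zd dd x not_full[OF hex, of x] C4[of d1 v1 x v4] C4[of d1 v4 x z] C4[of d2 v2 x z] C4[of d2 v5 x z] C4[of v1 v2 d2 x]
    C4[of v1 v6 d3 x] C4[of v1 v6 x d1] C4[of v2 d2 v5 x] C4[of v2 v1 d1 x] C4[of v2 v1 v6 x]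
    C4[of v2 v3 d3 x] C4[of v3 d3 v6 x] C4[of v3 d3 z x] C4[of v3 v4 v5 x] C4[of v4 v3 x d1]
    C4[of v4 v5 v6 x] C4[of v5 v4 x d2] C4[of v5 v6 x d2] C4[of v6 d3 z x] C4[of v6 v1 x v5]
    C4[of v6 v5 x d3] C4[of z d1 x d2] C4[of z d1 x d3] dom[of d1 v1 v2 v3 v4 x]
    dom[of d1 v1 v6 d3 z x] dom[of d1 v1 v6 v5 v4 x] dom[of d2 v2 v1 v6 v5 x]
    dom[of d2 v2 v3 d3 z x] P6[of v2 v1 d1 z d3 x] P6[of v3 d3 v6 v1 d1 x] P6[of v4 v3 d3 z d2 x]
    P6[of v4 v5 d2 v2 v1 x] P6[of x v1 v6 d3 z d2] P6[of z d1 v4 v5 v6 x] P6[of z x v1 v6 v5 v4]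
    unfolding hex_defs pent_def by (simp only: comm) sat
qed

text \<open>Supplies the premise \<open>types\<close> of \<open>blow_up_of_copy\<close> for F. The
  three \<open>quad\<close> vertices exclude all \<open>opp\<close> types, and then
  \<open>off_two_opp\<close> excludes vertices off the hexagon.\<close>

lemma F_type:
  assumes hex: "hex v1 v2 v3 v4 v5 v6"
    and q: "quad v1 v2 v3 v4 v5 v6 q1" "quad v3 v4 v5 v6 v1 v2 q2" "quad v5 v6 v1 v2 v3 v4 q3"
    and x: "x \<in> V"
  shows "tri v1 v2 v3 v4 v5 v6 x \<and> R x q1 \<and> \<not> R x q2 \<and> R x q3 \<or>
    tri v2 v3 v4 v5 v6 v1 x \<and> R x q1 \<and> R x q2 \<and> \<not> R x q3 \<or>
    tri v3 v4 v5 v6 v1 v2 x \<and> R x q1 \<and> R x q2 \<and> \<not> R x q3 \<or>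
    tri v4 v5 v6 v1 v2 v3 x \<and> \<not> R x q1 \<and> R x q2 \<and> R x q3 \<or>
    tri v5 v6 v1 v2 v3 v4 x \<and> \<not> R x q1 \<and> R x q2 \<and> R x q3 \<or>
    tri v6 v1 v2 v3 v4 v5 x \<and> R x q1 \<and> \<not> R x q2 \<and> R x q3 \<or>
    quad v1 v2 v3 v4 v5 v6 x \<and> R x q1 \<and> \<not> R x q2 \<and> \<not> R x q3 \<or>
    quad v3 v4 v5 v6 v1 v2 x \<and> \<not> R x q1 \<and> R x q2 \<and> \<not> R x q3 \<or>
    quad v5 v6 v1 v2 v3 v4 x \<and> \<not> R x q1 \<and> \<not> R x q2 \<and> R x q3"
proof -
  note r1 = hex_rot[OF hex] note r2 = hex_rot[OF r1] note r3 = hex_rot[OF r2]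
  note r4 = hex_rot[OF r3]
  have qq: "\<not> R q1 q2" "\<not> R q2 q3" "\<not> R q3 q1"
    using quad_anti[OF hex q(1,2)] quad_anti[OF r2 q(2,3)] quad_anti[OF r4 q(3,1)] by blast+
  have "\<not> opp v1 v2 v3 v4 v5 v6 d" "\<not> opp v2 v3 v4 v5 v6 v1 d" "\<not> opp v3 v4 v5 v6 v1 v2 d" for d
    using opp_quad[OF hex _ q(1)] opp_quad'[OF r1 _ q(1)] opp_quad[OF r2 _ q(2)] by blast+
  then have off: "\<not> off v1 v2 v3 v4 v5 v6 x" using off_two_opp[OF hex x] by blast
  show ?thesis
    using hex q qq off not_full[OF hex, of x] C4[of q1 v1 x v3] C4[of q1 v3 x v6] C4[of q2 v2 x v4] C4[of q2 v3 x v5] C4[of q2 v4 q3 x]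
    C4[of v1 q3 v4 x] C4[of v1 q3 v5 x] C4[of v1 v2 q2 x] C4[of v1 v2 v3 x] C4[of v1 v2 x q3]
    C4[of v1 v2 x v6] C4[of v2 q1 x q2] C4[of v2 q2 v5 x] C4[of v3 v2 x v4] C4[of v3 v4 x q1]
    C4[of v4 v3 x q3] C4[of v4 v3 x v5] C4[of v4 v5 v6 x] C4[of v5 q2 x q3] C4[of v5 v6 q1 x]
    C4[of v5 v6 x q2] P6[of q1 v2 q2 v4 q3 x] P6[of q3 v6 q1 v2 q2 x] P6[of v3 q1 v1 q3 v5 x]
    P6[of v4 q2 v2 v1 v6 x] P6[of v5 q3 v1 v2 v3 x] P6[of v6 q3 v4 q2 v2 x]
    P6[of x q3 v6 q1 v3 q2] P6[of x v1 q1 v3 v4 v5] P6[of x v1 q3 v5 q2 v3]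
    P6[of x v1 v6 v5 v4 v3] P6[of x v2 v1 v6 v5 v4] P6[of x v3 q1 v1 q3 v5]
    P6[of x v4 v5 v6 v1 v2] P6[of x v5 q2 v3 q1 v1] P6[of x v5 v6 v1 v2 v3]
    P6[of x v6 v5 v4 v3 v2]
    unfolding hex_defs by (simp only: comm) sat
qed

text \<open>
  \<open>E\<close> is the reflexive closure of the adjacency of the pattern. If every vertex looks, from every
  copy of the pattern, like one of its vertices, then putting a vertex into its place in the copy and
  looking at the next vertex from there shows that the classes form a blow-up.
\<close>

lemma blow_up_of_copy:
  fixes \<rho> :: "'h \<Rightarrow> 'a"
  assumes copy: "\<And>u w. R (\<rho> u) (\<rho> w) = E u w"
    and types: "\<And>\<sigma> x. \<lbrakk>\<And>u w. R (\<sigma> u) (\<sigma> w) = E u w; x \<in> V\<rbrakk> \<Longrightarrow> \<exists>u. \<forall>w. R x (\<sigma> w) = E u w"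
    and E: "\<And>u. E u u" "\<And>u w. E u w = E w u"
    and rigid: "\<And>u u' p. u \<noteq> u' \<Longrightarrow> \<exists>w. w \<noteq> p \<and> E u w \<noteq> E u' w"
  obtains B where "V = (\<Union>u. B u)" "\<And>u w. u \<noteq> w \<Longrightarrow> B u \<inter> B w = {}" "\<And>u. B u \<noteq> {}"
    "\<And>u w x y. x \<in> B u \<Longrightarrow> y \<in> B w \<Longrightarrow> R x y = E u w"
proof -
  define B where "B u = {x \<in> V. \<forall>w. R x (\<rho> w) = E u w}" for u
  have "V = (\<Union>u. B u)" using types[OF copy] by (auto simp: B_def)
  moreover have "B u \<inter> B w = {}" if "u \<noteq> w" for u w
    using rigid[OF that] by (auto simp: B_def)
  moreover have "\<rho> u \<in> B u" for u using copy E(1) R_in[of "\<rho> u" "\<rho> u"] by (simp add: B_def)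
  then have "B u \<noteq> {}" for u by blast
  moreover have "R x y = E u w" if x: "x \<in> B u" and y: "y \<in> B w" for u w x y
  proof -
    let ?\<sigma> = "\<rho>(u := x)"
    have "R (?\<sigma> s) (?\<sigma> t) = E s t" for s t
      using x copy E R_refl comm[of "\<rho> s" x] by (auto simp: B_def)
    moreover have "y \<in> V" using y by (simp add: B_def)
    ultimately obtain w' where w': "\<And>s. R y (?\<sigma> s) = E w' s" using types[of ?\<sigma> y] by blast
    \<comment> \<open>\<open>\<rho>\<close> and \<open>?\<sigma>\<close> agree outside
      \<open>u\<close>, and by \<open>rigid\<close> a pattern vertex is determined by its
      adjacencies outside any one position.\<close>
    have "E w s = E w' s" if "s \<noteq> u" for s using y w'[of s] that by (simp add: B_def)
    then have "w = w'" using rigid[of w w' u] by blast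
    then show ?thesis using w'[of u] comm[of x y] E(2)[of u w] by simp
  qed
  ultimately show thesis by (rule that)
qed

end

section \<open>Blow-ups of the Petersen graph and of F\<close>

fun F_nbhd :: "F_vertex \<Rightarrow> F_vertex set" where
  "F_nbhd U1 = {U6, U1, U2, Q1, Q3}"
| "F_nbhd U2 = {U1, U2, U3, Q1, Q2}"
| "F_nbhd U3 = {U2, U3, U4, Q1, Q2}"
| "F_nbhd U4 = {U3, U4, U5, Q2, Q3}"
| "F_nbhd U5 = {U4, U5, U6, Q2, Q3}"
| "F_nbhd U6 = {U5, U6, U1, Q1, Q3}"
| "F_nbhd Q1 = {U6, U1, U2, U3, Q1}"
| "F_nbhd Q2 = {U2, U3, U4, U5, Q2}"
| "F_nbhd Q3 = {U4, U5, U6, U1, Q3}"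

lemma all_F: "(\<forall>w. P w) \<longleftrightarrow> P U1 \<and> P U2 \<and> P U3 \<and> P U4 \<and> P U5 \<and> P U6 \<and> P Q1 \<and> P Q2 \<and> P Q3"
  by (rule iffI, blast, rule allI, rename_tac w, case_tac w, simp_all)

lemma ex_F: "(\<exists>w. P w) \<longleftrightarrow> P U1 \<or> P U2 \<or> P U3 \<or> P U4 \<or> P U5 \<or> P U6 \<or> P Q1 \<or> P Q2 \<or> P Q3"
  using all_F[of "\<lambda>w. \<not> P w"] by blast

lemma F_nbhd_iff: "w \<in> F_nbhd u \<longleftrightarrow> u = w \<or> (u, w) \<in> parcs F_graph"
  by (cases u; cases w) (simp_all add: F_graph_def symcl_def)

lemma F_nbhd_sym: "w \<in> F_nbhd u \<longleftrightarrow> u \<in> F_nbhd w"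
  by (cases u; cases w) simp_all

lemma F_nbhd_rigid: "u \<noteq> u' \<Longrightarrow> \<exists>w. w \<noteq> p \<and> (w \<in> F_nbhd u) \<noteq> (w \<in> F_nbhd u')"
  unfolding ex_F by (cases u; cases u') auto

text \<open>\<open>V1\<close>, \dots, \<open>V6\<close> is a hexagon, \<open>Di\<close> sees \<open>Vi\<close> and the vertex opposite to it.\<close>

datatype P_vertex = V1 | V2 | V3 | V4 | V5 | V6 | D1 | D2 | D3 | Z

fun P_nbhd :: "P_vertex \<Rightarrow> P_vertex set" where
  "P_nbhd V1 = {V6, V1, V2, D1}"
| "P_nbhd V2 = {V1, V2, V3, D2}"
| "P_nbhd V3 = {V2, V3, V4, D3}"
| "P_nbhd V4 = {V3, V4, V5, D1}"
| "P_nbhd V5 = {V4, V5, V6, D2}"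
| "P_nbhd V6 = {V5, V6, V1, D3}"
| "P_nbhd D1 = {V1, V4, D1, Z}"
| "P_nbhd D2 = {V2, V5, D2, Z}"
| "P_nbhd D3 = {V3, V6, D3, Z}"
| "P_nbhd Z = {D1, D2, D3, Z}"

text \<open>An isomorphism onto the Kneser graph. \<open>Z\<close> is {0, 1}, the hexagon consists
  of the pairs with exactly one element in {0, 1}, and each of \<open>D1\<close>, \<open>D2\<close>,
  \<open>D3\<close> is a pair in {2, 3, 4}.\<close>

fun P_pair :: "P_vertex \<Rightarrow> nat set" where
  "P_pair V1 = {0, 2}"
| "P_pair V2 = {1, 3}"
| "P_pair V3 = {0, 4}"
| "P_pair V4 = {1, 2}"
| "P_pair V5 = {0, 3}"
| "P_pair V6 = {1, 4}"
| "P_pair D1 = {3, 4}"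
| "P_pair D2 = {2, 4}"
| "P_pair D3 = {2, 3}"
| "P_pair Z = {0, 1}"

lemma all_P: "(\<forall>w. P w) \<longleftrightarrow>
    P V1 \<and> P V2 \<and> P V3 \<and> P V4 \<and> P V5 \<and> P V6 \<and> P D1 \<and> P D2 \<and> P D3 \<and> P Z"
  by (rule iffI, blast, rule allI, rename_tac w, case_tac w, simp_all)

lemma ex_P: "(\<exists>w. P w) \<longleftrightarrow>
    P V1 \<or> P V2 \<or> P V3 \<or> P V4 \<or> P V5 \<or> P V6 \<or> P D1 \<or> P D2 \<or> P D3 \<or> P Z"
  using all_P[of "\<lambda>w. \<not> P w"] by blast

lemma P_nbhd_pair: "w \<in> P_nbhd u \<longleftrightarrow> u = w \<or> P_pair u \<inter> P_pair w = {}"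
  by (cases u; cases w) simp_all

lemma P_nbhd_sym: "w \<in> P_nbhd u \<longleftrightarrow> u \<in> P_nbhd w"
  by (cases u; cases w) simp_all

lemma P_nbhd_rigid: "u \<noteq> u' \<Longrightarrow> \<exists>w. w \<noteq> p \<and> (w \<in> P_nbhd u) \<noteq> (w \<in> P_nbhd u')"
  unfolding ex_P by (cases u; cases u') auto

lemma P_pair_inj: "inj P_pair"
proof (rule injI)
  fix u w assume "P_pair u = P_pair w"
  moreover have "P_pair w \<noteq> {}" by (cases w) simp_all
  \<comment> \<open>A non-empty pair is not disjoint from itself, so the pair alone determines the
    open neighbourhood.\<close>
  ultimately have "P_nbhd u - {u} = P_nbhd w - {w}"
    by (auto simp: P_nbhd_pair)
  then show "u = w" by (cases u; cases w) (simp_all, auto)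
qed

lemma P_pair_range: "range P_pair = pverts petersen_graph"
proof -
  have "P_pair u \<subseteq> {..<5} \<and> card (P_pair u) = 2" for u by (cases u) simp_all
  then have sub: "range P_pair \<subseteq> {A. A \<subseteq> {..<5} \<and> card A = 2}" by blast
  have UNIV: "(UNIV :: P_vertex set) = {V1, V2, V3, V4, V5, V6, D1, D2, D3, Z}"
    using P_vertex.exhaust by blast
  have "card (UNIV :: P_vertex set) = 10" unfolding UNIV by simp
  then have "card (range P_pair) = 10" using P_pair_inj by (simp add: card_image)
  moreover have "card {A. A \<subseteq> {..<5::nat} \<and> card A = 2} = 10"
    by (simp add: n_subsets choose_two)
  moreover have "finite {A. A \<subseteq> {..<5::nat} \<and> card A = 2}" by simp
  ultimately have "range P_pair = {A. A \<subseteq> {..<5} \<and> card A = 2}"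
    using sub card_subset_eq by metis
  then show ?thesis by (simp add: petersen_graph_def Let_def)
qed

section \<open>Recognition of the two blow-ups\<close>

context C4_P6_free_atom
begin

lemma F_blow_up:
  assumes hex: "hex v1 v2 v3 v4 v5 v6"
    and q: "quad v1 v2 v3 v4 v5 v6 q1" "quad v3 v4 v5 v6 v1 v2 q2" "quad v5 v6 v1 v2 v3 v4 q3"
  obtains B where "V = (\<Union>u. B u)" "\<And>u w. u \<noteq> w \<Longrightarrow> B u \<inter> B w = {}" "\<And>u. B u \<noteq> {}"
    "\<And>u w x y. x \<in> B u \<Longrightarrow> y \<in> B w \<Longrightarrow> R x y = (w \<in> F_nbhd u)"
proof (rule blow_up_of_copy[of "case_F_vertex v1 v2 v3 v4 v5 v6 q1 q2 q3" "\<lambda>u w. w \<in> F_nbhd u"])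
  note r2 = hex_rot[OF hex_rot[OF hex]] note r4 = hex_rot[OF hex_rot[OF r2]]
  have in_V: "q1 \<in> V" "q2 \<in> V" "q3 \<in> V" using q R_in by (auto simp: quad_def)
  note refl = hex_in[OF hex, THEN R_refl] in_V[THEN R_refl]
  note qq = quad_anti[OF hex q(1,2)] quad_anti[OF r2 q(2,3)] quad_anti[OF r4 q(3,1)]
  let ?\<rho> = "case_F_vertex v1 v2 v3 v4 v5 v6 q1 q2 q3"
  have "\<forall>u w. R (?\<rho> u) (?\<rho> w) = (w \<in> F_nbhd u)"
    unfolding all_F using hex q refl qq
    apply (simp only: hex_defs F_vertex.case F_nbhd.simps insert_iff empty_iff F_vertex.distinct simp_thms)
    by (simp only: comm) sat
  then show "R (?\<rho> u) (?\<rho> w) = (w \<in> F_nbhd u)" for u w by blast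
  show "\<exists>u. \<forall>w. R x (\<sigma> w) = (w \<in> F_nbhd u)"
    if \<sigma>: "\<And>u w. R (\<sigma> u) (\<sigma> w) = (w \<in> F_nbhd u)" and x: "x \<in> V" for \<sigma> x
  proof -
    have "hex (\<sigma> U1) (\<sigma> U2) (\<sigma> U3) (\<sigma> U4) (\<sigma> U5) (\<sigma> U6)"
      "quad (\<sigma> U1) (\<sigma> U2) (\<sigma> U3) (\<sigma> U4) (\<sigma> U5) (\<sigma> U6) (\<sigma> Q1)"
      "quad (\<sigma> U3) (\<sigma> U4) (\<sigma> U5) (\<sigma> U6) (\<sigma> U1) (\<sigma> U2) (\<sigma> Q2)"
      "quad (\<sigma> U5) (\<sigma> U6) (\<sigma> U1) (\<sigma> U2) (\<sigma> U3) (\<sigma> U4) (\<sigma> Q3)"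
      by (simp_all add: hex_defs \<sigma>)
    from F_type[OF this x] show ?thesis
      unfolding ex_F all_F by (elim disjE) (simp_all add: hex_defs)
  qed
  show "u \<in> F_nbhd u" for u by (cases u) simp_all
  show "(w \<in> F_nbhd u) = (u \<in> F_nbhd w)" for u w by (rule F_nbhd_sym)
  show "\<exists>w. w \<noteq> p \<and> (w \<in> F_nbhd u) \<noteq> (w \<in> F_nbhd u')" if "u \<noteq> u'" for u u' p
    using that by (rule F_nbhd_rigid)
qed (rule that; assumption)

lemma petersen_blow_up:
  assumes hex: "hex v1 v2 v3 v4 v5 v6"
    and d: "opp v1 v2 v3 v4 v5 v6 d1" "opp v2 v3 v4 v5 v6 v1 d2" "opp v3 v4 v5 v6 v1 v2 d3"
    and z: "z \<in> V" "off v1 v2 v3 v4 v5 v6 z"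
  obtains B where "V = (\<Union>u. B u)" "\<And>u w. u \<noteq> w \<Longrightarrow> B u \<inter> B w = {}" "\<And>u. B u \<noteq> {}"
    "\<And>u w x y. x \<in> B u \<Longrightarrow> y \<in> B w \<Longrightarrow> R x y = (w \<in> P_nbhd u)"
proof (rule blow_up_of_copy[of "case_P_vertex v1 v2 v3 v4 v5 v6 d1 d2 d3 z" "\<lambda>u w. w \<in> P_nbhd u"])
  note r1 = hex_rot[OF hex] note r2 = hex_rot[OF r1]
  have in_V: "d1 \<in> V" "d2 \<in> V" "d3 \<in> V" using d R_in by (auto simp: opp_def)
  note refl = hex_in[OF hex, THEN R_refl] in_V[THEN R_refl] R_refl[OF z(1)]
  have dd: "\<not> R d1 d2" "\<not> R d2 d3" "\<not> R d3 d1"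
    using opp_anti[OF hex d(1,2)] opp_anti[OF r1 d(2,3)] opp_anti[OF r2 d(3), of d1] d(1)
      opp_flip[of v1 v2 v3 v4 v5 v6 d1] by blast+
  have "off v2 v3 v4 v5 v6 v1 z" "off v3 v4 v5 v6 v1 v2 z" using z by (auto simp: off_def)
  then have zd: "R z d1" "R z d2" "R z d3"
    using opp_off[OF hex d(1) z] opp_off[OF r1 d(2) z(1)] opp_off[OF r2 d(3) z(1)] by blast+
  let ?\<rho> = "case_P_vertex v1 v2 v3 v4 v5 v6 d1 d2 d3 z"
  have "\<forall>u w. R (?\<rho> u) (?\<rho> w) = (w \<in> P_nbhd u)"
    unfolding all_P using hex d z(2) refl dd zd
    apply (simp only: hex_defs P_vertex.case P_nbhd.simps insert_iff empty_iff P_vertex.distinct simp_thms)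
    by (simp only: comm) sat
  then show "R (?\<rho> u) (?\<rho> w) = (w \<in> P_nbhd u)" for u w by blast
  show "\<exists>u. \<forall>w. R x (\<sigma> w) = (w \<in> P_nbhd u)"
    if \<sigma>: "\<And>u w. R (\<sigma> u) (\<sigma> w) = (w \<in> P_nbhd u)" and x: "x \<in> V" for \<sigma> x
  proof -
    have "hex (\<sigma> V1) (\<sigma> V2) (\<sigma> V3) (\<sigma> V4) (\<sigma> V5) (\<sigma> V6)"
      "opp (\<sigma> V1) (\<sigma> V2) (\<sigma> V3) (\<sigma> V4) (\<sigma> V5) (\<sigma> V6) (\<sigma> D1)"
      "opp (\<sigma> V2) (\<sigma> V3) (\<sigma> V4) (\<sigma> V5) (\<sigma> V6) (\<sigma> V1) (\<sigma> D2)"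
      "opp (\<sigma> V3) (\<sigma> V4) (\<sigma> V5) (\<sigma> V6) (\<sigma> V1) (\<sigma> V2) (\<sigma> D3)"
      "off (\<sigma> V1) (\<sigma> V2) (\<sigma> V3) (\<sigma> V4) (\<sigma> V5) (\<sigma> V6) (\<sigma> Z)"
      "R (\<sigma> Z) (\<sigma> D1)" "R (\<sigma> Z) (\<sigma> D2)" "R (\<sigma> Z) (\<sigma> D3)"
      by (simp_all add: hex_defs \<sigma>)
    from petersen_type[OF this x] show ?thesis
      unfolding ex_P all_P by (elim disjE) (simp_all add: hex_defs)
  qed
  show "u \<in> P_nbhd u" for u by (cases u) simp_all
  show "(w \<in> P_nbhd u) = (u \<in> P_nbhd w)" for u w by (rule P_nbhd_sym)
  show "\<exists>w. w \<noteq> p \<and> (w \<in> P_nbhd u) \<noteq> (w \<in> P_nbhd u')" if "u \<noteq> u'" for u u' p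
    using that by (rule P_nbhd_rigid)
qed (rule that; assumption)

end

section \<open>The graph-theoretic statement\<close>

lemma is_blow_upI:
  fixes g :: "'h \<Rightarrow> 'b"
  assumes G: "pair_wf_digraph G" and g: "inj g" "range g = pverts H"
    and E: "\<And>u w. E u w \<longleftrightarrow> u = w \<or> (g u, g w) \<in> parcs H"
    and B: "pverts G = (\<Union>u. B u)" "\<And>u w. u \<noteq> w \<Longrightarrow> B u \<inter> B w = {}" "\<And>u. B u \<noteq> {}"
      "\<And>u w x y. x \<in> B u \<Longrightarrow> y \<in> B w \<Longrightarrow> (x = y \<or> (x, y) \<in> parcs G) \<longleftrightarrow> E u w"
  shows "is_blow_up G H"
proof -
  have E_refl: "E u u" for u using E by blast
  have disj: "u = w" if "x \<in> B u" "x \<in> B w" for x u w using B(2)[of u w] that by blast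
  have inv_g: "inv g (g u) = u" for u using g(1) by simp
  \<comment> \<open>Reflexivity of \<open>E\<close> makes each class a clique.\<close>
  have cl: "clique G (B u)" for u
    using B(4)[of _ u _ u] E_refl[of u] unfolding clique_def B(1) by blast
  have arcs: "(x, y) \<in> parcs G \<longleftrightarrow> (g u, g w) \<in> parcs H"
    if "g u \<noteq> g w" "x \<in> B u" "y \<in> B w" for u w x y
  proof -
    have "x \<noteq> y" using disj that by blast
    then show ?thesis using B(4)[OF that(2,3)] E[of u w] that(1) by auto
  qed
  show ?thesis
    unfolding is_blow_up_def
  proof (intro exI conjI)
    let ?B = "\<lambda>v. B (inv g v)"
    show "pverts G = (\<Union>v\<in>pverts H. ?B v)" using B(1) by (simp add: g(2)[symmetric] inv_g)
    show "\<forall>u\<in>pverts H. \<forall>v\<in>pverts H. u \<noteq> v \<longrightarrow> ?B u \<inter> ?B v = {}"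
      using disj by (auto simp: g(2)[symmetric] inv_g)
    show "\<forall>v\<in>pverts H. ?B v \<noteq> {} \<and> clique G (?B v)" using B(3) cl by blast
    show "\<forall>u\<in>pverts H. \<forall>v\<in>pverts H. u \<noteq> v \<longrightarrow>
        (\<forall>x\<in>?B u. \<forall>y\<in>?B v. (x, y) \<in> parcs G \<longleftrightarrow> (u, v) \<in> parcs H)"
    proof (intro ballI impI)
      fix a b x y assume ab: "a \<in> pverts H" "b \<in> pverts H" "a \<noteq> b" and xy: "x \<in> ?B a" "y \<in> ?B b"
      have "g (inv g a) = a" "g (inv g b) = b" using ab g(2) by (metis f_inv_into_f)+
      then show "(x, y) \<in> parcs G \<longleftrightarrow> (a, b) \<in> parcs H" using arcs[OF _ xy] ab(3) by simp
    qed
  qed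
qed

text \<open>\<open>digraph_iso\<close> asks for a map from the induced subgraph to \<open>H\<close>,
  hence the inverse \<open>g\<close> of the embedding \<open>f\<close>. Arcs are pairs, so it acts
  on them as \<open>map_prod g g\<close>.\<close>

lemma contains_inducedI:
  assumes G: "pair_wf_digraph G" and H: "parcs H \<subseteq> pverts H \<times> pverts H"
    and f: "inj_on f (pverts H)" "f ` pverts H \<subseteq> pverts G"
    and arcs: "\<And>u v. u \<in> pverts H \<Longrightarrow> v \<in> pverts H \<Longrightarrow> (f u, f v) \<in> parcs G \<longleftrightarrow> (u, v) \<in> parcs H"
  shows "contains_induced G H"
proof -
  interpret pair_wf_digraph G by fact
  define g where "g = the_inv_into (pverts H) f"
  have g: "g (f u) = u" if "u \<in> pverts H" for u
    using f(1) that by (simp add: g_def the_inv_into_f_f)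
  let ?G = "with_proj G \<restriction> (f ` pverts H)"
  let ?h = "\<lparr>iso_verts = g, iso_arcs = map_prod g g, iso_head = snd, iso_tail = fst\<rparr>
    :: ('a, 'a \<times> 'a, 'b, 'b \<times> 'b) digraph_isomorphism"
  have inj: "inj_on g (f ` pverts H)" using g by (auto simp: inj_on_def)
  have arcsG: "arcs ?G = map_prod f f ` parcs H"
    using H arcs by (auto simp: image_iff) (metis SigmaD1 SigmaD2 map_prod_simp subsetD)
  have gf: "map_prod g g (map_prod f f e) = e" if "e \<in> parcs H" for e
    using that H g by (cases e) auto
  have "map_prod f f (map_prod g g x) = x" if "x \<in> map_prod f f ` parcs H" for x
    using that by (rule imageE) (simp only: gf)
  then have inj_gg: "inj_on (map_prod g g) (map_prod f f ` parcs H)"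
    by (rule inj_on_inverseI)
  have "induced_subgraph ?G (with_proj G)"
    using f(2) by (intro induced_induce)
  moreover have "pre_digraph.digraph_isomorphism ?G ?h"
    unfolding pre_digraph.digraph_isomorphism_def
  proof (intro conjI)
    show "wf_digraph ?G" using f(2) by (intro wellformed_induce_subgraph)
    show "inj_on (iso_verts ?h) (verts ?G)" using inj by simp
    show "inj_on (iso_arcs ?h) (arcs ?G)"
      using inj_gg by (simp only: arcsG digraph_isomorphism.select_convs)
  qed auto
  moreover have "map_prod g g ` map_prod f f ` parcs H = parcs H"
    using image_cong[OF refl gf, of "parcs H"] by (simp only: image_image image_ident)
  then have "with_proj H = app_iso ?h ?G"
    unfolding app_iso_def using arcsG g by (simp add: with_proj_def image_image)
  ultimately show ?thesis unfolding contains_induced_def digraph_iso_def by blast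
qed

lemma path_graph_arc: "(i, j) \<in> parcs (path_graph t) \<longleftrightarrow> i < t \<and> j < t \<and> (j = Suc i \<or> i = Suc j)"
  by (auto simp: path_graph_def symcl_def)

lemma cycle_graph_arc: "(i, j) \<in> parcs (cycle_graph t) \<longleftrightarrow>
    i < t \<and> j < t \<and> (j = Suc i mod t \<or> i = Suc j mod t)"
  by (auto simp: cycle_graph_def symcl_def)

text \<open>The instance of \<open>R\<close>; the membership conditions keep the case x = y inside
  the vertex set.\<close>

definition adjeq :: "'a pair_pre_digraph \<Rightarrow> 'a \<Rightarrow> 'a \<Rightarrow> bool" where
  "adjeq G x y \<longleftrightarrow> x \<in> pverts G \<and> y \<in> pverts G \<and> (x = y \<or> (x, y) \<in> parcs G)"

section \<open>The graph as an instance of the locales\<close>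

context pair_graph
begin

lemma adjeq_sym: "adjeq G x y = adjeq G y x"
  using pair_sym_arcs by (auto simp: adjeq_def symmetric_def sym_def)

lemma adjeq_arc: "x \<noteq> y \<Longrightarrow> adjeq G x y = ((x, y) \<in> parcs G)"
  using wellformed' by (auto simp: adjeq_def)

lemma adjeq_refl: "x \<in> pverts G \<Longrightarrow> adjeq G x x"
  by (simp add: adjeq_def)

lemma no_loop: "(x, x) \<notin> parcs G"
  using pair_no_loops by fastforce

lemma induced_of_list:
  fixes xs :: "'a list"
  assumes V: "set xs \<subseteq> pverts G" and H: "pverts H = {..<length xs}"
    and HH: "parcs H \<subseteq> pverts H \<times> pverts H"
    and ne: "\<And>i j. i < j \<Longrightarrow> j < length xs \<Longrightarrow> xs ! i \<noteq> xs ! j"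
    and adj: "\<And>i j. i < j \<Longrightarrow> j < length xs \<Longrightarrow> adjeq G (xs ! i) (xs ! j) \<longleftrightarrow> (i, j) \<in> parcs H"
    and symH: "sym (parcs H)" and loop: "\<And>i. (i, i) \<notin> parcs H"
  shows "contains_induced G H"
proof (rule contains_inducedI[of G H "\<lambda>i. xs ! i"])
  show "pair_wf_digraph G" by unfold_locales
  show "inj_on ((!) xs) (pverts H)"
    unfolding H using ne by (metis inj_onI lessThan_iff nat_neq_iff)
  show "(!) xs ` pverts H \<subseteq> pverts G" using V by (auto simp: H)
  show "(xs ! i, xs ! j) \<in> parcs G \<longleftrightarrow> (i, j) \<in> parcs H" if "i \<in> pverts H" "j \<in> pverts H" for i j
  proof (cases i j rule: linorder_cases)
    case less
    then show ?thesis using adj[OF less] ne[OF less] that by (simp add: H adjeq_arc)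
  next
    case equal
    then show ?thesis using loop no_loop by simp
  next
    case greater
    then have "adjeq G (xs ! i) (xs ! j) \<longleftrightarrow> (i, j) \<in> parcs H"
      using adj[OF greater] that adjeq_sym[of "xs ! i"] symD[OF symH] by (auto simp: H)
    then show ?thesis using ne[OF greater] that greater by (metis H adjeq_arc lessThan_iff)
  qed
qed (fact HH)

lemma adjeq_P6:
  assumes "\<not> contains_induced G (path_graph 6)"
    and "adjeq G a b" "adjeq G b c" "adjeq G c d" "adjeq G d e" "adjeq G e f"
    and "\<not> adjeq G a c" "\<not> adjeq G a d" "\<not> adjeq G a e" "\<not> adjeq G a f" "\<not> adjeq G b d"
      "\<not> adjeq G b e" "\<not> adjeq G b f" "\<not> adjeq G c e" "\<not> adjeq G c f" "\<not> adjeq G d f"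
  shows False
proof -
  let ?xs = "[a, b, c, d, e, f]"
  have V: "set ?xs \<subseteq> pverts G" using assms by (auto simp: adjeq_def)
  have ne: "a \<noteq> b" "b \<noteq> c" "c \<noteq> d" "d \<noteq> e" "e \<noteq> f" using assms by blast+
  have ne': "a \<noteq> c" "a \<noteq> d" "a \<noteq> e" "a \<noteq> f" "b \<noteq> d" "b \<noteq> e" "b \<noteq> f" "c \<noteq> e" "c \<noteq> f" "d \<noteq> f"
    using assms V adjeq_refl by auto
  have six: "j = 1 \<or> j = 2 \<or> j = 3 \<or> j = 4 \<or> j = 5" if "i < j" "j < length ?xs" for i j :: nat
    using that by auto
  have "contains_induced G (path_graph 6)"
  proof (rule induced_of_list[OF V])
    show "?xs ! i \<noteq> ?xs ! j" if "i < j" "j < length ?xs" for i j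
      using six[OF that] that(1) ne ne' by (auto simp: less_Suc_eq numeral_eq_Suc)
    show "adjeq G (?xs ! i) (?xs ! j) \<longleftrightarrow> (i, j) \<in> parcs (path_graph 6)"
      if "i < j" "j < length ?xs" for i j
      using six[OF that] that(1) assms(2-) unfolding path_graph_arc
      by (auto simp: less_Suc_eq numeral_eq_Suc)
    show "sym (parcs (path_graph 6))" by (auto simp: sym_def path_graph_arc)
  qed (auto simp: path_graph_def symcl_def)
  then show False using assms(1) by blast
qed

lemma adjeq_C4:
  assumes "\<not> contains_induced G (cycle_graph 4)"
    and "adjeq G a b" "adjeq G b c" "adjeq G c d" "adjeq G d a" "\<not> adjeq G a c" "\<not> adjeq G b d"
  shows False
proof -
  let ?xs = "[a, b, c, d]"
  have V: "set ?xs \<subseteq> pverts G" using assms by (auto simp: adjeq_def)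
  have ad: "adjeq G a d" using assms(5) adjeq_sym by blast
  have ne: "a \<noteq> b" "b \<noteq> c" "c \<noteq> d" "a \<noteq> d" using assms adjeq_sym by blast+
  have ne': "a \<noteq> c" "b \<noteq> d" using assms V adjeq_refl by auto
  have pairs: "i = 0 \<and> j = 1 \<or> i = 0 \<and> j = 2 \<or> i = 0 \<and> j = 3 \<or> i = 1 \<and> j = 2 \<or>
      i = 1 \<and> j = 3 \<or> i = 2 \<and> j = 3" if "i < j" "j < length ?xs" for i j :: nat
    using that by simp presburger
  have "contains_induced G (cycle_graph 4)"
  proof (rule induced_of_list[OF V])
    show "?xs ! i \<noteq> ?xs ! j" if "i < j" "j < length ?xs" for i j
      using pairs[OF that] ne ne' by (elim disjE) simp_all
    show "adjeq G (?xs ! i) (?xs ! j) \<longleftrightarrow> (i, j) \<in> parcs (cycle_graph 4)"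
      if "i < j" "j < length ?xs" for i j
      using pairs[OF that] assms(2-) ad by (elim disjE) (simp_all add: cycle_graph_arc)
    show "sym (parcs (cycle_graph 4))" by (auto simp: sym_def cycle_graph_arc)
    show "(i, i) \<notin> parcs (cycle_graph 4)" for i
      unfolding cycle_graph_arc by (auto simp: mod_Suc)
  qed (auto simp: cycle_graph_def symcl_def)
  then show False using assms(1) by blast
qed

text \<open>Let \<open>K\<close> be the attachment of \<open>X\<close>. If a vertex lies outside
  \<open>X\<close> and \<open>K\<close>, then deleting \<open>K\<close> leaves at least two
  components, one inside \<open>X\<close> and one outside, whereas the connected graph
  \<open>G\<close> has at most one. So \<open>K\<close> would be a clique cutset.\<close>

lemma separation:
  assumes conn: "Digraph_Component.connected (with_proj G)"
    and no_cutset: "\<not> (\<exists>K. clique_cutset G K)"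
    and X: "X \<noteq> {}" "X \<subseteq> pverts G"
    and K: "clique G {w \<in> pverts G - X. \<exists>x\<in>X. adjeq G x w}"
  shows "X \<union> {w \<in> pverts G - X. \<exists>x\<in>X. adjeq G x w} = pverts G"
proof (rule ccontr)
  define K where "K = {w \<in> pverts G - X. \<exists>x\<in>X. adjeq G x w}"
  define S where "S = pverts G - K"
  let ?H = "with_proj G \<restriction> S"
  assume "\<not> ?thesis"
  then have "X \<union> K \<noteq> pverts G" "X \<union> K \<subseteq> pverts G" using X by (auto simp: K_def)
  then obtain y where y: "y \<in> S" "y \<notin> X" by (auto simp: S_def)
  obtain x where x: "x \<in> X" using X by blast
  have XS: "X \<subseteq> S" using X by (auto simp: S_def K_def)
  have H_arcs: "(u, v) \<in> arcs_ends ?H \<longleftrightarrow> (u, v) \<in> parcs G \<and> u \<in> S \<and> v \<in> S" for u v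
    by (auto simp: arcs_ends_conv)
  interpret H: sym_digraph ?H
  proof (intro sym_digraph.intro sym_digraph_axioms.intro)
    show "wf_digraph ?H" by (auto simp: S_def)
    show "symmetric ?H"
      using pair_sym_arcs H_arcs by (simp add: symmetric_def sym_def)
  qed
  \<comment> \<open>An arc leaving \<open>X\<close> ends in \<open>K\<close>, which has been
    deleted, so reachability does not lead out of \<open>X\<close>.\<close>
  have stay: "v \<in> X" if "u \<rightarrow>\<^sup>*\<^bsub>?H\<^esub> v" "u \<in> X" for u v
    using that
  proof (induction rule: H.reachable_induct)
    case (step v w)
    then have "v \<in> X" "(v, w) \<in> parcs G" "w \<in> S" using H_arcs by auto
    then show ?case using wellformed' by (auto simp: S_def K_def adjeq_def)
  qed
  have sccs: "?H \<restriction> {v. u \<rightarrow>\<^sup>*\<^bsub>?H\<^esub> v} \<in> H.sccs" if "u \<in> S" for u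
    using H.induce_reachable_is_in_sccs[of u] that by simp
  have "\<not> x \<rightarrow>\<^sup>*\<^bsub>?H\<^esub> y" using stay x y by blast
  moreover have "y \<rightarrow>\<^sup>*\<^bsub>?H\<^esub> y" using y by simp
  ultimately have ne: "?H \<restriction> {v. x \<rightarrow>\<^sup>*\<^bsub>?H\<^esub> v} \<noteq> ?H \<restriction> {v. y \<rightarrow>\<^sup>*\<^bsub>?H\<^esub> v}"
    by (metis induce_subgraph_verts mem_Collect_eq)
  have "H.sccs_verts \<subseteq> Pow S"
    using H.reachable_in_verts(1) by (fastforce simp: H.in_sccs_verts_conv_reachable)
  moreover have "finite S" using pair_finite_verts by (simp add: S_def)
  ultimately have "finite H.sccs" unfolding H.sccs_conv_sccs_verts by (auto intro: finite_subset)
  then have "card {?H \<restriction> {v. x \<rightarrow>\<^sup>*\<^bsub>?H\<^esub> v}, ?H \<restriction> {v. y \<rightarrow>\<^sup>*\<^bsub>?H\<^esub> v}} \<le> card H.sccs"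
    using sccs x y XS by (intro card_mono) auto
  then have two: "2 \<le> card H.sccs" using ne by simp
  have sc: "strongly_connected (with_proj G)"
    using symmetric_connected_imp_strongly_connected[OF pair_sym_arcs] conn by simp
  have "T = pverts G" if "T \<in> sccs_verts" for T
  proof -
    have "T \<noteq> {}" using that by (simp add: in_sccs_verts_conv_reachable)
    then obtain u where u: "u \<in> T" by blast
    have T: "u \<in> T \<Longrightarrow> v \<in> T \<Longrightarrow> u \<rightarrow>\<^sup>*\<^bsub>with_proj G\<^esub> v" for u v
      using that by (simp add: in_sccs_verts_conv_reachable)
    then have TV: "T \<subseteq> pverts G" using reachable_in_verts(1) by fastforce
    have "v \<in> T" if v: "v \<in> pverts G" for v
    proof -
      have "u \<rightarrow>\<^sup>*\<^bsub>with_proj G\<^esub> v" "v \<rightarrow>\<^sup>*\<^bsub>with_proj G\<^esub> u"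
        using sc u TV v by (auto simp: strongly_connected_def)
      then show ?thesis using \<open>T \<in> sccs_verts\<close> u unfolding in_sccs_verts_conv_reachable by blast
    qed
    then show ?thesis using TV by blast
  qed
  then have "sccs_verts \<subseteq> {pverts G}" by blast
  then have "card sccs_verts \<le> 1" using card_mono[of "{pverts G}"] by simp
  moreover have "card sccs \<le> card sccs_verts"
    unfolding sccs_conv_sccs_verts using \<open>sccs_verts \<subseteq> _\<close>
    by (intro card_image_le) (auto intro: finite_subset)
  ultimately have "card sccs < card H.sccs" using two by simp
  then have "clique_cutset G K" using K by (simp add: clique_cutset_def K_def S_def)
  then show False using no_cutset by blast
qed

end

lemma (in pair_graph) card_closed_nbhd:
  assumes "x \<in> pverts G"
  shows "card {y. adjeq G x y} = Suc (out_degree (with_proj G) x)"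
proof -
  have "{y. adjeq G x y} = insert x (snd ` out_arcs (with_proj G) x)"
    using assms wellformed' by (force simp: adjeq_def out_arcs_def image_iff)
  moreover have "x \<notin> snd ` out_arcs (with_proj G) x"
    using no_loop by (auto simp: out_arcs_def)
  moreover have "finite (out_arcs (with_proj G) x)"
    using pair_finite_arcs by (simp add: out_arcs_def)
  moreover have "inj_on snd (out_arcs (with_proj G) x)"
    by (auto simp: out_arcs_def inj_on_def)
  ultimately show ?thesis by (simp add: card_image out_degree_def)
qed

theorem theorem1:
  fixes G :: "'a pair_pre_digraph"
  assumes "pair_graph G"
    and "Digraph_Component.connected (with_proj G)"
    and "\<not> contains_induced G (path_graph 6)"
    and "\<not> contains_induced G (cycle_graph 4)"
    and "\<not> (\<exists>K. clique_cutset G K)"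
  shows "(\<exists>v \<in> pverts G. real (out_degree (with_proj G) v) \<le> 3 / 2 * real (clique_number G) - 1)
       \<or> (\<exists>v. universal_vertex G v)
       \<or> is_blow_up G petersen_graph
       \<or> is_blow_up G F_graph"
proof (cases "\<exists>v. universal_vertex G v")
  case no_universal: False
  interpret pair_graph G by fact
  have wf: "pair_wf_digraph G" by unfold_locales
  interpret A: C4_P6_free "pverts G" "adjeq G"
  proof
    show "pverts G \<noteq> {}"
      using assms(2) by (simp add: Digraph_Component.connected_def strongly_connected_def)
  qed (fact pair_finite_verts adjeq_refl adjeq_sym adjeq_C4[OF assms(4)] adjeq_P6[OF assms(3)]
      | simp add: adjeq_def)+
  have clq: "A.clq K \<longleftrightarrow> clique G K" for K
    unfolding A.clq_def clique_def adjeq_def by blast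
  interpret A: C4_P6_free_atom "pverts G" "adjeq G"
  proof
    show "X \<union> A.nb X = pverts G" if "X \<noteq> {}" "X \<subseteq> pverts G" "A.clq (A.nb X)" for X
      using separation[OF assms(2,5) that(1,2)] that(3) unfolding clq A.nb_def by blast
    show "\<exists>y\<in>pverts G. \<not> adjeq G x y" if "x \<in> pverts G" for x
      using no_universal that by (auto simp: universal_vertex_def adjeq_def)
  qed
  have \<omega>: "A.\<omega> = clique_number G" by (simp add: A.\<omega>_def clique_number_def clq)
  have small: ?thesis if "A.small x" for x
  proof -
    have x: "x \<in> pverts G" and "2 * card (A.N x) \<le> 3 * clique_number G"
      using that by (auto simp: A.small_def \<omega>)
    \<comment> \<open>The closed neighbourhood counts \<open>x\<close> itself, which accounts for
      the -1 in the degree bound.\<close>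
    then have "2 * Suc (out_degree (with_proj G) x) \<le> 3 * clique_number G"
      using card_closed_nbhd[OF x] by (simp add: A.N_def)
    then have "real (2 * Suc (out_degree (with_proj G) x)) \<le> real (3 * clique_number G)"
      by (simp only: of_nat_le_iff)
    then have "real (out_degree (with_proj G) x) \<le> 3 / 2 * real (clique_number G) - 1" by simp
    then show ?thesis using x by blast
  qed
  have adj: "adjeq G x y \<longleftrightarrow> x = y \<or> (x, y) \<in> parcs G" if "x \<in> pverts G" "y \<in> pverts G" for x y
    using that by (auto simp: adjeq_def)
  show ?thesis
  proof (cases "\<exists>a b c d e f. A.hex a b c d e f")
    case True
    then obtain a b c d e f where "A.hex a b c d e f" by blast
    then show ?thesis
    proof (cases rule: A.hexagon_cases)
      case (1 x)
      then show ?thesis by (rule small)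
    next
      case 2
      then obtain B where B: "pverts G = (\<Union>u. B u)" "\<And>u w. u \<noteq> w \<Longrightarrow> B u \<inter> B w = {}"
        "\<And>u. B u \<noteq> {}" "\<And>u w x y. x \<in> B u \<Longrightarrow> y \<in> B w \<Longrightarrow> adjeq G x y = (w \<in> P_nbhd u)"
        by (rule A.petersen_blow_up) blast
      have "is_blow_up G petersen_graph"
      proof (rule is_blow_upI[OF wf P_pair_inj P_pair_range _ B(1-3)])
        show "w \<in> P_nbhd u \<longleftrightarrow> u = w \<or> (P_pair u, P_pair w) \<in> parcs petersen_graph" for u w
          using P_nbhd_pair[of w u] P_pair_range
          by (auto simp: petersen_graph_def Let_def)
        show "(x = y \<or> (x, y) \<in> parcs G) = (w \<in> P_nbhd u)" if "x \<in> B u" "y \<in> B w" for u w x y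
          using B(4)[OF that] adj[of x y] that B(1) by blast
      qed
      then show ?thesis by blast
    next
      case 3
      then obtain B where B: "pverts G = (\<Union>u. B u)" "\<And>u w. u \<noteq> w \<Longrightarrow> B u \<inter> B w = {}"
        "\<And>u. B u \<noteq> {}" "\<And>u w x y. x \<in> B u \<Longrightarrow> y \<in> B w \<Longrightarrow> adjeq G x y = (w \<in> F_nbhd u)"
        by (rule A.F_blow_up) blast
      have "is_blow_up G F_graph"
      proof (rule is_blow_upI[OF wf _ _ _ B(1-3), of id])
        show "w \<in> F_nbhd u \<longleftrightarrow> u = w \<or> (id u, id w) \<in> parcs F_graph" for u w
          using F_nbhd_iff[of w u] by simp
        show "(x = y \<or> (x, y) \<in> parcs G) = (w \<in> F_nbhd u)" if "x \<in> B u" "y \<in> B w" for u w x y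
          using B(4)[OF that] adj[of x y] that B(1) by blast
      qed (simp_all add: F_graph_def)
      then show ?thesis by blast
    qed
  next
    case False
    then interpret A: hexagon_free_atom "pverts G" "adjeq G" by unfold_locales blast
    show ?thesis using A.small_vertex_exists small by blast
  qed
qed blast

end
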